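(* Let $a<b$, $K\ge2$, $\mathcal{I}=\{1,\dots,K\}$, $\mathscr{D}\subseteq D_{cdf}([a,b])$ nonempty and convex, and $\mathsf{T}:D_{cdf}([a,b])\to\mathbb{R}$ with $|\mathsf{T}(F)-\mathsf{T}(G)|\le C\|F-G\|_\infty$ for all $F\in\mathscr{D}$, $G\in D_{cdf}([a,b])$ and some $C>0$. Suppose $\mathscr{D}$ contains $H_1,H_2$ with $J_\tau:=\tau H_1+(1-\tau)H_2\in\mathscr{D}$ for all $\tau\in[0,1]$ and $\mathsf{T}(J_{\tau_2})-\mathsf{T}(J_{\tau_1})\ge c_-(\tau_2-\tau_1)$ for all $0\le\tau_1\le\tau_2\le1$ and some $c_->0$. Let $\mathscr{M}_K\subseteq\mathscr{S}_K$ be closed with at least two elements. Then there exists a constant $c>0$, independent of $K$, $n$ and $\mathscr{M}_K$, such that for every policy $\pi$ with recommendations in $\mathscr{M}_K$ and every randomization measure $\mathbb{P}_G$, $$\sup_{F^1,\dots,F^K\in\{J_\tau:\tau\in[0,1]\}}\mathbb{E}[r_n(\pi,\mathscr{M}_K)]\ge c\,\kappa(\mathscr{M}_K)\sqrt{K/n}\quad\text{for every }n\ge K,$$ the supremum being over all potential outcome distributions with independent marginals with cdfs in $\{J_\tau:\tau\in[0,1]\}$. Furthermore, $$\kappa(\mathscr{M}_K)\ge\frac{1}{272}\max_{\delta\in\mathscr{M}_K}\|\delta\|^2\cdot\min_{j=1,\dots,K}\Big(\max_{\delta\in\mathscr{M}_K}\delta_j-\min_{\delta\in\mathscr{M}_K}\delta_j\Big)^3,$$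 and $\kappa(\mathscr{M}_K)\ge\big(\max(\min_{j=1,\dots,K}\max_{\delta\in\mathscr{M}_K}\delta_j-1/2,\,0)\big)^2$.
   Context: $D_{cdf}([a,b])$ is the set of cdfs $F$ on $\mathbb{R}$ with $F(a-)=0$, $F(b)=1$; $\|F-G\|_\infty=\sup_x|F(x)-G(x)|$; $\mathscr{S}_K=\{\delta\in[0,1]^K:\sum_i\delta_i=1\}$; $\langle\delta,\mathbf{F}\rangle=\sum_i\delta_iF^i$; $\|\cdot\|$ is the Euclidean norm. Define $$\kappa(\mathscr{M}_K)=\sup\Big\{\Big[\max_{\delta\in\mathscr{M}_K}v'\delta-\sup_{\delta\in\mathscr{T}}v'\delta\Big]\wedge\min_{i=1,\dots,K}\Big[\max_{\delta\in\mathscr{M}_K}(v'\delta+w_i\delta_i)-\sup_{\delta\in\mathscr{M}_K\setminus\mathscr{T}}(v'\delta+w_i\delta_i)\Big]\Big\},$$ the supremum over all nonempty Borel sets $\mathscr{T}\subsetneq\mathscr{M}_K$, all $v\in[-1,1]^K$ and all $w_i\in[-1,1]$, $i=1,\dots,K$. Setting: potential outcomes $Y_t=(Y_{1,t},\dots,Y_{K,t})$ i.i.d. over $t$, $Y_{i,t}$ with cdf $F^i$; randomization variables $G_t$ i.i.d. with law $\mathbb{P}_G$, independent of $(Y_t)$. A policy with recommendations in $\mathscr{M}_K$: for each $n\ge K$, measurable $\pi_{n,t}:([a,b]\times\mathbb{R})^{t-1}\times\mathbb{R}\to\mathcal{I}$ ($t\le n$) and $\pi_{n,n+1}:([a,b]\times\mathbb{R})^n\times\mathbb{R}\to\mathscr{M}_K$,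 with inputs $(Z_0,G_1)=(G_1)$, $Z_{t-1}=(Y_{\pi_{n,t-1}(Z_{t-2},G_{t-1}),t-1},G_{t-1},\dots,Y_{\pi_{n,1}(G_1),1},G_1)$. Regret: $r_n(\pi,\mathscr{M}_K)=\max_{\delta\in\mathscr{M}_K}\mathsf{T}(\langle\delta,\mathbf{F}\rangle)-\mathsf{T}(\langle\pi_{n,n+1}(Z_n,G_{n+1}),\mathbf{F}\rangle)$. *)

theory Defs
  imports "HOL-Probability.Probability"
begin

definition Dcdf :: "real \<Rightarrow> real \<Rightarrow> (real \<Rightarrow> real) set" where
  "Dcdf a b = {F. (\<exists>M. real_distribution M \<and> F = cdf M) \<and> (F \<longlongrightarrow> 0) (at_left a) \<and> F b = 1}"

definition supdist :: "(real \<Rightarrow> real) \<Rightarrow> (real \<Rightarrow> real) \<Rightarrow> real" where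
  "supdist F G = (SUP x. \<bar>F x - G x\<bar>)"

definition convex_fset :: "(real \<Rightarrow> real) set \<Rightarrow> bool" where
  "convex_fset D \<longleftrightarrow> (\<forall>F\<in>D. \<forall>G\<in>D. \<forall>t\<in>{0..1}. (\<lambda>x. t * F x + (1 - t) * G x) \<in> D)"

definition Jmix :: "(real \<Rightarrow> real) \<Rightarrow> (real \<Rightarrow> real) \<Rightarrow> real \<Rightarrow> (real \<Rightarrow> real)" where
  "Jmix H1 H2 \<tau> = (\<lambda>x. \<tau> * H1 x + (1 - \<tau>) * H2 x)"

definition simplexK :: "nat \<Rightarrow> (nat \<Rightarrow> real) set" where
  "simplexK K = {\<delta>. (\<forall>i\<in>{1..K}. 0 \<le> \<delta> i \<and> \<delta> i \<le> 1) \<and> (\<Sum>i\<in>{1..K}. \<delta> i) = 1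
                   \<and> (\<forall>i. i \<notin> {1..K} \<longrightarrow> \<delta> i = 0)}"

definition ip :: "nat \<Rightarrow> (nat \<Rightarrow> real) \<Rightarrow> (nat \<Rightarrow> real) \<Rightarrow> real" where
  "ip K v \<delta> = (\<Sum>i\<in>{1..K}. v i * \<delta> i)"

definition sqnorm :: "nat \<Rightarrow> (nat \<Rightarrow> real) \<Rightarrow> real" where
  "sqnorm K \<delta> = (\<Sum>i\<in>{1..K}. (\<delta> i)\<^sup>2)"

definition mix :: "nat \<Rightarrow> (nat \<Rightarrow> real) \<Rightarrow> (nat \<Rightarrow> real \<Rightarrow> real) \<Rightarrow> (real \<Rightarrow> real)" where
  "mix K \<delta> F = (\<lambda>x. \<Sum>i\<in>{1..K}. \<delta> i * F i x)"

definition kappa_obj :: "nat \<Rightarrow> (nat \<Rightarrow> real) set \<Rightarrow> (nat \<Rightarrow> real) set \<Rightarrow> (nat \<Rightarrow> real) \<Rightarrow> (nat \<Rightarrow> real) \<Rightarrow> real" where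
  "kappa_obj K M S v w =
     min ((SUP \<delta>\<in>M. ip K v \<delta>) - (SUP \<delta>\<in>S. ip K v \<delta>))
         (Min ((\<lambda>i. (SUP \<delta>\<in>M. ip K v \<delta> + w i * \<delta> i) - (SUP \<delta>\<in>M - S. ip K v \<delta> + w i * \<delta> i)) ` {1..K}))"

definition kappa :: "nat \<Rightarrow> (nat \<Rightarrow> real) set \<Rightarrow> real" where
  "kappa K M = (SUP p \<in> {(S, v, w). S \<in> sets borel \<and> S \<noteq> {} \<and> S \<subset> M
                      \<and> (\<forall>i\<in>{1..K}. \<bar>v i\<bar> \<le> 1 \<and> \<bar>w i\<bar> \<le> 1)}.
                 kappa_obj K M (fst p) (fst (snd p)) (snd (snd p)))"

(* A policy: pol n t (Z_{t-1}, G_t) \<in> {1..K} for t \<in> {1..n}; recf n (Z_n, G_{n+1}) \<in> M.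
   A history Z_t is an extensional function on {1..t} with values (observed outcome, G). *)
definition is_policy :: "nat \<Rightarrow> (nat \<Rightarrow> real) set
    \<Rightarrow> (nat \<Rightarrow> nat \<Rightarrow> (nat \<Rightarrow> real \<times> real) \<times> real \<Rightarrow> nat)
    \<Rightarrow> (nat \<Rightarrow> (nat \<Rightarrow> real \<times> real) \<times> real \<Rightarrow> (nat \<Rightarrow> real)) \<Rightarrow> bool" where
  "is_policy K M pol recf \<longleftrightarrow>
     (\<forall>n\<ge>K.
        (\<forall>t\<in>{1..n}. pol n t \<in> (PiM {1..<t} (\<lambda>_. borel) \<Otimes>\<^sub>M borel) \<rightarrow>\<^sub>M count_space {1..K})
      \<and> recf n \<in> (PiM {1..n} (\<lambda>_. borel) \<Otimes>\<^sub>M borel) \<rightarrow>\<^sub>M borel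
      \<and> (\<forall>x\<in>space (PiM {1..n} (\<lambda>_. borel) \<Otimes>\<^sub>M borel). recf n x \<in> M))"

(* omega t = (Y_t, G_t), Y_t the vector of potential outcomes; hist ... t = Z_t *)
fun hist :: "(nat \<Rightarrow> nat \<Rightarrow> (nat \<Rightarrow> real \<times> real) \<times> real \<Rightarrow> nat) \<Rightarrow> nat
    \<Rightarrow> (nat \<Rightarrow> (nat \<Rightarrow> real) \<times> real) \<Rightarrow> nat \<Rightarrow> (nat \<Rightarrow> real \<times> real)" where
  "hist pol n \<omega> 0 = (\<lambda>s. undefined)"
| "hist pol n \<omega> (Suc t) =
     (let i = pol n (Suc t) (hist pol n \<omega> t, snd (\<omega> (Suc t)))
      in (hist pol n \<omega> t)(Suc t := (fst (\<omega> (Suc t)) i, snd (\<omega> (Suc t)))))"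

definition outcome_space :: "nat \<Rightarrow> (nat \<Rightarrow> real \<Rightarrow> real) \<Rightarrow> real measure \<Rightarrow> nat
    \<Rightarrow> (nat \<Rightarrow> (nat \<Rightarrow> real) \<times> real) measure" where
  "outcome_space K F PG n =
     PiM {1..Suc n} (\<lambda>t. PiM {1..K} (\<lambda>i. interval_measure (F i)) \<Otimes>\<^sub>M PG)"

definition regret :: "nat \<Rightarrow> (nat \<Rightarrow> real) set \<Rightarrow> ((real \<Rightarrow> real) \<Rightarrow> real) \<Rightarrow> (nat \<Rightarrow> real \<Rightarrow> real)
    \<Rightarrow> (nat \<Rightarrow> nat \<Rightarrow> (nat \<Rightarrow> real \<times> real) \<times> real \<Rightarrow> nat)
    \<Rightarrow> (nat \<Rightarrow> (nat \<Rightarrow> real \<times> real) \<times> real \<Rightarrow> (nat \<Rightarrow> real))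
    \<Rightarrow> nat \<Rightarrow> (nat \<Rightarrow> (nat \<Rightarrow> real) \<times> real) \<Rightarrow> real" where
  "regret K M T F pol recf n \<omega> =
     (SUP \<delta>\<in>M. T (mix K \<delta> F)) - T (mix K (recf n (hist pol n \<omega> n, snd (\<omega> (Suc n)))) F)"

definition exp_regret :: "nat \<Rightarrow> (nat \<Rightarrow> real) set \<Rightarrow> ((real \<Rightarrow> real) \<Rightarrow> real) \<Rightarrow> (nat \<Rightarrow> real \<Rightarrow> real)
    \<Rightarrow> real measure
    \<Rightarrow> (nat \<Rightarrow> nat \<Rightarrow> (nat \<Rightarrow> real \<times> real) \<times> real \<Rightarrow> nat)
    \<Rightarrow> (nat \<Rightarrow> (nat \<Rightarrow> real \<times> real) \<times> real \<Rightarrow> (nat \<Rightarrow> real))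
    \<Rightarrow> nat \<Rightarrow> real" where
  "exp_regret K M T F PG pol recf n =
     (\<integral>\<omega>. regret K M T F pol recf n \<omega> \<partial>(outcome_space K F PG n))"

end

theory Submission
  imports Defs
begin

text \<open>For mixtures \<open>J \<tau>\<close> the functional \<open>T\<close> increases at least linearly in \<open>\<tau>\<close>, so choosing a recommendation
  is a linear optimisation problem over \<open>M\<close>. Give arm \<open>i\<close> the weight \<open>1/2 + \<epsilon> v i\<close> with \<open>\<epsilon>\<close> of order
  \<open>sqrt (K / n)\<close>; some arm is pulled at most \<open>n / K\<close> times on average, and moving its weight by
  \<open>\<epsilon> w i\<close> changes the law of the observed history only by a likelihood ratio whose mean logarithm is
  bounded below. Hence the policy cannot avoid both recommending in \<open>S\<close> under the first instance and
  recommending outside \<open>S\<close> under the second; either mistake costs \<open>\<epsilon>\<close> times the quantity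
  maximised in \<open>\<kappa>\<close>.\<close>

subsection \<open>Lower bounds for the complexity of the recommendation set\<close>

text \<open>The obstacle is that the laws behind \<open>H1\<close> and \<open>H2\<close> are
  arbitrary, possibly mutually singular. Weights near 1/2 remove it: such a mixture dominates both
  components, so shifting a weight by at most \<epsilon> multiplies the law by a density within 4
  \<epsilon> of 1. Its logarithm has mean at least -2 (4 \<epsilon>)^2 per pull, because the linear
  term averages to zero, and n / K expected pulls bring the total to at least -1/2 for \<epsilon> =
  sqrt (K / n) / 8. The change of measure covers observed histories only: outcomes of arms that are
  not pulled contribute no factor, which is what turns n into n / K. The constant 128 is 8 from
  \<epsilon>, 8 from the testing bound and 2 from passing from the sum of two regrets to their
  maximum. The form of \<kappa> matches this scheme: S, v and w are fixed before the rarely pulled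
  arm is known, hence the minimum over all arms.\<close>

lemma compact_subset_simplexK:
  assumes "M \<subseteq> simplexK K" and "closed M"
  shows "compact M"
proof -
  \<comment> \<open>Closedness on functions from \<open>nat\<close> refers to the product topology,
    so compactness is Tychonoff for the cube. Points of the simplex vanish outside {1..K} and hence
    lie in it.\<close>
  have "compactin (product_topology (\<lambda>_. euclidean) UNIV) (PiE UNIV (\<lambda>_::nat. {0..1::real}))"
    by (simp add: compactin_PiE)
  then have "compact (PiE UNIV (\<lambda>_::nat. {0..1::real}))"
    by (simp add: euclidean_product_topology)
  moreover have "M \<subseteq> PiE UNIV (\<lambda>_. {0..1})"
    using assms(1) by (force simp: simplexK_def PiE_def)
  ultimately show ?thesis
    using assms(2) by (metis closed_Int_compact inf.absorb_iff1)
qed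

lemma continuous_on_coordinate [continuous_intros]: "continuous_on A (\<lambda>\<delta>::nat \<Rightarrow> real. \<delta> i)"
  by (rule continuous_on_subset[OF continuous_on_product_coordinates subset_UNIV])

lemma simplexK_bounds:
  assumes "\<delta> \<in> simplexK K"
  shows "0 \<le> \<delta> i" "\<delta> i \<le> 1"
  using assms by (cases "i \<in> {1..K}"; auto simp: simplexK_def)+

lemma simplexK_pair_le:
  assumes "\<delta> \<in> simplexK K" and "i \<in> {1..K}" "j \<in> {1..K}" "i \<noteq> j"
  shows "\<delta> i + \<delta> j \<le> 1"
proof -
  have "(\<Sum>k\<in>{i,j}. \<delta> k) \<le> (\<Sum>k\<in>{1..K}. \<delta> k)"
    using assms by (intro sum_mono2) (auto simp: simplexK_bounds)
  then show ?thesis using assms by (simp add: simplexK_def)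
qed

lemma abs_ip_le_one:
  assumes "\<delta> \<in> simplexK K" and "\<And>i. i \<in> {1..K} \<Longrightarrow> \<bar>v i\<bar> \<le> 1"
  shows "\<bar>ip K v \<delta>\<bar> \<le> 1"
proof -
  have "\<bar>ip K v \<delta>\<bar> \<le> (\<Sum>i\<in>{1..K}. \<delta> i)"
    unfolding ip_def
    using assms simplexK_bounds[OF assms(1)]
    by (intro order.trans[OF sum_abs] sum_mono) (auto simp: abs_mult mult_left_le_one_le)
  then show ?thesis using assms by (simp add: simplexK_def)
qed

locale recommendation_set =
  fixes K :: nat and M :: "(nat \<Rightarrow> real) set"
  assumes K: "2 \<le> K"
    and M: "M \<subseteq> simplexK K" "closed M"
    and two_elements: "\<exists>x\<in>M. \<exists>y\<in>M. x \<noteq> y"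
begin

lemma nonempty: "M \<noteq> {}"
  using two_elements by auto

lemma compact: "compact M"
  using M by (rule compact_subset_simplexK)

lemma coordinate_attained:
  obtains x y where "x \<in> M" "y \<in> M" "(SUP \<delta>\<in>M. \<delta> j) = x j" "(INF \<delta>\<in>M. \<delta> j) = y j"
    "\<And>\<delta>. \<delta> \<in> M \<Longrightarrow> y j \<le> \<delta> j" "\<And>\<delta>. \<delta> \<in> M \<Longrightarrow> \<delta> j \<le> x j"
proof -
  obtain x where x: "x \<in> M" "\<And>\<delta>. \<delta> \<in> M \<Longrightarrow> \<delta> j \<le> x j"
    using continuous_attains_sup[OF compact nonempty continuous_on_coordinate] by blast
  obtain y where y: "y \<in> M" "\<And>\<delta>. \<delta> \<in> M \<Longrightarrow> y j \<le> \<delta> j"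
    using continuous_attains_inf[OF compact nonempty continuous_on_coordinate] by blast
  have "(SUP \<delta>\<in>M. \<delta> j) = x j" "(INF \<delta>\<in>M. \<delta> j) = y j"
    using x y by (auto intro!: cSup_eq_maximum cInf_eq_minimum)
  with x y show ?thesis using that by blast
qed

lemma abs_perturbed_ip_le:
  assumes "\<delta> \<in> M" "i \<in> {1..K}" "\<And>i. i \<in> {1..K} \<Longrightarrow> \<bar>v i\<bar> \<le> 1 \<and> \<bar>w i\<bar> \<le> 1"
  shows "\<bar>ip K v \<delta> + w i * \<delta> i\<bar> \<le> 2"
proof -
  have "\<bar>ip K v \<delta>\<bar> \<le> 1" using abs_ip_le_one assms M by blast
  moreover have "\<bar>w i * \<delta> i\<bar> \<le> 1"
    using assms M simplexK_bounds[of \<delta> K i] by (auto simp: abs_mult intro!: mult_le_one)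
  ultimately show ?thesis by linarith
qed

lemma bdd_above_ip:
  assumes "\<And>i. i \<in> {1..K} \<Longrightarrow> \<bar>v i\<bar> \<le> 1"
  shows "bdd_above ((\<lambda>\<delta>. ip K v \<delta>) ` M)"
proof (rule bdd_aboveI2)
  show "ip K v \<delta> \<le> 1" if "\<delta> \<in> M" for \<delta>
    using abs_ip_le_one[of \<delta> K v] assms that M by (simp add: abs_le_iff subset_iff)
qed

lemma bdd_above_perturbed_ip:
  assumes "i \<in> {1..K}" "\<And>i. i \<in> {1..K} \<Longrightarrow> \<bar>v i\<bar> \<le> 1 \<and> \<bar>w i\<bar> \<le> 1"
  shows "bdd_above ((\<lambda>\<delta>. ip K v \<delta> + w i * \<delta> i) ` M)"
proof (rule bdd_aboveI2)
  show "ip K v \<delta> + w i * \<delta> i \<le> 2" if "\<delta> \<in> M" for \<delta>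
    using abs_perturbed_ip_le[where v=v and w=w, OF that assms] by linarith
qed

text \<open>A real \<open>SUP\<close> is meaningful only for families bounded above; this bound is
  what allows \<open>kappa_geI\<close> to place a single choice of S, v, w below
  \<open>kappa\<close>.\<close>

lemma kappa_obj_le:
  assumes "S \<noteq> {}" "S \<subseteq> M" and v: "\<And>i. i \<in> {1..K} \<Longrightarrow> \<bar>v i\<bar> \<le> 1"
  shows "kappa_obj K M S v w \<le> 2"
proof -
  have b: "\<bar>ip K v \<delta>\<bar> \<le> 1" if "\<delta> \<in> M" for \<delta>
    using abs_ip_le_one that M v by blast
  have "(SUP \<delta>\<in>M. ip K v \<delta>) \<le> 1"
    using b nonempty by (intro cSUP_least) (auto simp: abs_le_iff)
  moreover have "- 1 \<le> (SUP \<delta>\<in>S. ip K v \<delta>)"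
  proof -
    obtain s where s: "s \<in> S" using assms by auto
    have "- 1 \<le> ip K v s" using b[of s] s assms by auto
    also have "\<dots> \<le> (SUP \<delta>\<in>S. ip K v \<delta>)"
      using b assms s by (intro cSUP_upper bdd_aboveI2[where M=1]) (auto simp: abs_le_iff)
    finally show ?thesis .
  qed
  ultimately show ?thesis by (simp add: kappa_obj_def)
qed

text \<open>Every lower bound for \<open>kappa\<close> below comes from exhibiting S, v, w.
  Pointwise gaps to one competitor replace the differences of suprema; the competitor z may depend
  on the arm i, while S and v may not.\<close>

lemma kappa_geI:
  assumes S: "S \<in> sets borel" "S \<noteq> {}" "S \<subset> M"
    and vw: "\<And>i. i \<in> {1..K} \<Longrightarrow> \<bar>v i\<bar> \<le> 1 \<and> \<bar>w i\<bar> \<le> 1"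
    and x: "x \<in> M" "\<And>\<delta>. \<delta> \<in> S \<Longrightarrow> ip K v \<delta> + r \<le> ip K v x"
    and y: "\<And>i. i \<in> {1..K} \<Longrightarrow> \<exists>z\<in>M. \<forall>\<delta>\<in>M - S. ip K v \<delta> + w i * \<delta> i + r \<le> ip K v z + w i * z i"
  shows "r \<le> kappa K M"
proof -
  have b: "bdd_above ((\<lambda>\<delta>. ip K v \<delta>) ` M)"
    using vw by (intro bdd_above_ip) auto
  have b2: "bdd_above ((\<lambda>\<delta>. ip K v \<delta> + w i * \<delta> i) ` M)" if "i \<in> {1..K}" for i
    using that vw by (rule bdd_above_perturbed_ip)
  have "(SUP \<delta>\<in>S. ip K v \<delta>) \<le> ip K v x - r"
    using S x by (intro cSUP_least) (auto simp: algebra_simps)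
  moreover have "ip K v x \<le> (SUP \<delta>\<in>M. ip K v \<delta>)"
    using b x by (intro cSUP_upper)
  moreover have "r \<le> (SUP \<delta>\<in>M. ip K v \<delta> + w i * \<delta> i) - (SUP \<delta>\<in>M - S. ip K v \<delta> + w i * \<delta> i)"
    if i: "i \<in> {1..K}" for i
  proof -
    obtain z where z: "z \<in> M" "\<forall>\<delta>\<in>M - S. ip K v \<delta> + w i * \<delta> i + r \<le> ip K v z + w i * z i"
      using y[OF i] by blast
    have "(SUP \<delta>\<in>M - S. ip K v \<delta> + w i * \<delta> i) \<le> ip K v z + w i * z i - r"
      using S z by (intro cSUP_least) (auto simp: algebra_simps)
    moreover have "ip K v z + w i * z i \<le> (SUP \<delta>\<in>M. ip K v \<delta> + w i * \<delta> i)"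
      using b2[OF i] z by (intro cSUP_upper)
    ultimately show ?thesis by linarith
  qed
  ultimately have "r \<le> kappa_obj K M S v w"
    using K by (auto simp: kappa_obj_def)
  also have "\<dots> \<le> kappa K M"
    unfolding kappa_def
  proof (rule cSUP_upper2[where x="(S, v, w)"])
    show "bdd_above ((\<lambda>p. kappa_obj K M (fst p) (fst (snd p)) (snd (snd p))) `
      {(S, v, w). S \<in> sets borel \<and> S \<noteq> {} \<and> S \<subset> M \<and> (\<forall>i\<in>{1..K}. \<bar>v i\<bar> \<le> 1 \<and> \<bar>w i\<bar> \<le> 1)})"
      by (rule bdd_aboveI2[where M=2]) (auto simp del: atLeastAtMost_iff intro!: kappa_obj_le)
  qed (use S vw in auto)
  finally show ?thesis .
qed

lemma kappa_nonneg: "0 \<le> kappa K M"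
proof -
  obtain x y where "x \<in> M" "y \<in> M" "x \<noteq> y" using two_elements by blast
  then show ?thesis
    by (intro kappa_geI[where S="{x}" and v="\<lambda>_. 0" and w="\<lambda>_. 0" and x=x]) (auto simp: ip_def)
qed

text \<open>Let \<open>d\<close> maximise the norm over \<open>M\<close>. Then the inner product of \<open>d\<close> and \<open>d - \<delta>\<close> is at least half the
  squared distance of \<open>\<delta>\<close> and \<open>d\<close>, so a small multiple of \<open>d\<close> serves as \<open>v\<close> and the complement of a
  ball around \<open>d\<close> as \<open>S\<close>.\<close>

lemma kappa_ge_sqnorm:
  "1 / 272 * (SUP \<delta>\<in>M. sqnorm K \<delta>)
     * (Min ((\<lambda>j. (SUP \<delta>\<in>M. \<delta> j) - (INF \<delta>\<in>M. \<delta> j)) ` {1..K})) ^ 3 \<le> kappa K M"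
proof -
  define \<rho> where "\<rho> = Min ((\<lambda>j. (SUP \<delta>\<in>M. \<delta> j) - (INF \<delta>\<in>M. \<delta> j)) ` {1..K})"
  have \<rho>_le: "\<exists>x\<in>M. \<exists>y\<in>M. \<rho> \<le> x j - y j" if "j \<in> {1..K}" for j
  proof -
    obtain x y where "x \<in> M" "y \<in> M" "(SUP \<delta>\<in>M. \<delta> j) = x j" "(INF \<delta>\<in>M. \<delta> j) = y j"
      using coordinate_attained[of j] by metis
    moreover have "\<rho> \<le> (SUP \<delta>\<in>M. \<delta> j) - (INF \<delta>\<in>M. \<delta> j)"
      using that by (auto simp: \<rho>_def)
    ultimately show ?thesis by force
  qed
  have "\<rho> \<in> (\<lambda>j. (SUP \<delta>\<in>M. \<delta> j) - (INF \<delta>\<in>M. \<delta> j)) ` {1..K}"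
    unfolding \<rho>_def using K by (intro Min_in) auto
  then obtain j where j: "j \<in> {1..K}" "\<rho> = (SUP \<delta>\<in>M. \<delta> j) - (INF \<delta>\<in>M. \<delta> j)" by auto
  obtain x y where "x \<in> M" "y \<in> M" "(SUP \<delta>\<in>M. \<delta> j) = x j" "(INF \<delta>\<in>M. \<delta> j) = y j" 
    "\<And>\<delta>. \<delta> \<in> M \<Longrightarrow> y j \<le> \<delta> j"
    using coordinate_attained[of j] by metis
  then have "0 \<le> \<rho>" "\<rho> \<le> 1"
    using j simplexK_bounds[of x K j] simplexK_bounds[of y K j] M by (auto simp: subset_iff)
  have sq_le: "sqnorm K \<delta> \<le> 1" if "\<delta> \<in> M" for \<delta>
  proof -
    have "\<delta> \<in> simplexK K" using that M by auto
    then have "sqnorm K \<delta> \<le> (\<Sum>i\<in>{1..K}. \<delta> i)"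
      unfolding sqnorm_def using simplexK_bounds
      by (intro sum_mono) (auto simp: power2_eq_square intro!: mult_left_le)
    then show ?thesis using \<open>\<delta> \<in> simplexK K\<close> by (simp add: simplexK_def)
  qed
  have "continuous_on M (sqnorm K)"
    unfolding sqnorm_def[abs_def] by (intro continuous_intros)
  then obtain d where d: "d \<in> M" "\<And>\<delta>. \<delta> \<in> M \<Longrightarrow> sqnorm K \<delta> \<le> sqnorm K d"
    using continuous_attains_sup[OF compact nonempty] by blast
  have sup: "(SUP \<delta>\<in>M. sqnorm K \<delta>) = sqnorm K d"
    using d by (auto intro!: cSup_eq_maximum)
  have dK: "d \<in> simplexK K" using d M by auto
  show ?thesis
  proof (cases "\<rho> = 0")
    case True
    then show ?thesis unfolding \<rho>_def[symmetric] using kappa_nonneg by simp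
  next
    case False
    then have \<rho>: "0 < \<rho>" "\<rho> \<le> 1" using \<open>0 \<le> \<rho>\<close> \<open>\<rho> \<le> 1\<close> by auto
    \<comment> \<open>The radius \<rho> / 4 and the factor \<rho> / 8 in v balance the two gaps.
      Leaving the ball costs at least \<rho> / 8 times half of \<rho>^2 / 16, that is \<rho>^3 /
      256. Inside it, the shift along w i gains at least \<rho> / 2 - \<rho> / 4, of which v takes
      back at most \<rho> / 8.\<close>
    define S where "S = {\<delta>\<in>M. \<rho>\<^sup>2 / 16 \<le> (\<Sum>i\<in>{1..K}. (\<delta> i - d i)\<^sup>2)}"
    define v where "v i = \<rho> / 8 * d i" for i
    have far: "\<exists>z\<in>M. \<rho> / 2 \<le> \<bar>z i - d i\<bar>" if "i \<in> {1..K}" for i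
    proof -
      obtain x y where "x \<in> M" "y \<in> M" "\<rho> \<le> x i - y i" using \<rho>_le[OF \<open>i \<in> {1..K}\<close>] by blast
      then have "\<rho> / 2 \<le> \<bar>x i - d i\<bar> \<or> \<rho> / 2 \<le> \<bar>y i - d i\<bar>" by argo
      then show ?thesis using \<open>x \<in> M\<close> \<open>y \<in> M\<close> by blast
    qed
    then obtain z where z: "\<And>i. i \<in> {1..K} \<Longrightarrow> z i \<in> M \<and> \<rho> / 2 \<le> \<bar>z i i - d i\<bar>" by metis
    \<comment> \<open>The shift points from d towards z i, the direction in which M extends at least
      \<rho> / 2 in coordinate i.\<close>
    define w where "w i = sgn (z i i - d i)" for i
    have "closed S"
      unfolding S_def using M(2)
      by (intro closed_Collect_conj[OF _ closed_Collect_le, of "\<lambda>\<delta>. \<delta> \<in> M", simplified] continuous_intros)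
    have ip_v: "ip K v \<delta> = \<rho> / 8 * (\<Sum>i\<in>{1..K}. d i * \<delta> i)" for \<delta>
      by (simp add: ip_def v_def sum_distrib_left mult.assoc)
    have ip_d: "ip K v d = \<rho> / 8 * sqnorm K d"
      by (simp add: ip_v sqnorm_def power2_eq_square)
    have polar: "2 * (\<Sum>i\<in>{1..K}. d i * \<delta> i) = sqnorm K d + sqnorm K \<delta> - (\<Sum>i\<in>{1..K}. (\<delta> i - d i)\<^sup>2)" for \<delta>
      by (simp add: sqnorm_def sum_distrib_left sum.distrib[symmetric] sum_subtractf[symmetric]
          power2_diff mult.commute mult.left_commute)
    have "\<rho> ^ 3 / 256 \<le> kappa K M"
    proof (rule kappa_geI[where S=S and v=v and w=w and x=d])
      show "S \<in> sets borel" using \<open>closed S\<close> by auto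
      have 1: "1 \<in> {1..K}" using K by auto
      have "(\<rho> / 2)\<^sup>2 \<le> \<bar>z 1 1 - d 1\<bar>\<^sup>2" using z[OF 1] \<rho> by (intro power_mono) auto
      also have "\<dots> = (z 1 1 - d 1)\<^sup>2" by simp
      also have "\<dots> \<le> (\<Sum>i\<in>{1..K}. (z 1 i - d i)\<^sup>2)"
        using 1 by (intro member_le_sum) auto
      finally have "\<rho>\<^sup>2 / 4 \<le> (\<Sum>i\<in>{1..K}. (z 1 i - d i)\<^sup>2)" by (simp add: power_divide)
      moreover have "0 \<le> \<rho>\<^sup>2" by simp
      ultimately have "\<rho>\<^sup>2 / 16 \<le> (\<Sum>i\<in>{1..K}. (z 1 i - d i)\<^sup>2)" by argo
      then have "z 1 \<in> S" using z[OF 1] by (auto simp: S_def)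
      then show "S \<noteq> {}" by auto
      have "d \<notin> S" using \<rho> by (auto simp: S_def)
      moreover have "S \<subseteq> M" by (auto simp: S_def)
      ultimately show "S \<subset> M" using d(1) by blast
      show "\<bar>v i\<bar> \<le> 1 \<and> \<bar>w i\<bar> \<le> 1" if "i \<in> {1..K}" for i
        using simplexK_bounds[OF dK, of i] \<rho> mult_le_one[of \<rho> "d i"]
        by (auto simp: v_def w_def abs_mult abs_sgn_eq)
      show "d \<in> M" by fact
      show "ip K v \<delta> + \<rho> ^ 3 / 256 \<le> ip K v d" if "\<delta> \<in> S" for \<delta>
      proof -
        have "2 * (\<Sum>i\<in>{1..K}. d i * \<delta> i) \<le> 2 * sqnorm K d - \<rho>\<^sup>2 / 16"
          using that d(2)[of \<delta>] unfolding polar S_def by auto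
        then have "(\<Sum>i\<in>{1..K}. d i * \<delta> i) \<le> sqnorm K d - \<rho>\<^sup>2 / 32" by simp
        then have "ip K v \<delta> \<le> \<rho> / 8 * (sqnorm K d - \<rho>\<^sup>2 / 32)"
          unfolding ip_v using \<rho> by (intro mult_left_mono) auto
        then show ?thesis by (simp add: ip_d algebra_simps power2_eq_square power3_eq_cube)
      qed
      show "\<exists>z\<in>M. \<forall>\<delta>\<in>M - S. ip K v \<delta> + w i * \<delta> i + \<rho> ^ 3 / 256 \<le> ip K v z + w i * z i"
        if i: "i \<in> {1..K}" for i
      proof (intro bexI ballI)
        show "z i \<in> M" using z i by auto
        fix \<delta> assume \<delta>: "\<delta> \<in> M - S"
        have "2 * (\<Sum>i\<in>{1..K}. d i * \<delta> i) \<le> 2 * sqnorm K d"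
          using \<delta> d(2)[of \<delta>] sum_nonneg[of "{1..K}" "\<lambda>i. (\<delta> i - d i)\<^sup>2"] unfolding polar by auto
        then have "(\<Sum>i\<in>{1..K}. d i * \<delta> i) \<le> 1" using sq_le[OF d(1)] by linarith
        then have 1: "ip K v \<delta> \<le> \<rho> / 8" using \<rho> by (simp add: ip_v mult_left_le)
        have "0 \<le> ip K v (z i)"
          unfolding ip_v using \<rho> simplexK_bounds[OF dK] z[OF i] simplexK_bounds[of "z i" K] M
          by (intro mult_nonneg_nonneg sum_nonneg) auto
        have "(\<delta> i - d i)\<^sup>2 \<le> (\<Sum>i\<in>{1..K}. (\<delta> i - d i)\<^sup>2)"
          using i by (intro member_le_sum) auto
        also have "\<dots> \<le> (\<rho> / 4)\<^sup>2" using \<delta> by (auto simp: S_def power_divide)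
        finally have "\<bar>\<delta> i - d i\<bar> \<le> \<rho> / 4" using \<rho> by (simp add: power2_le_iff_abs_le)
        moreover have "w i * (\<delta> i - d i) \<le> \<bar>\<delta> i - d i\<bar>"
          by (auto simp: w_def sgn_if)
        moreover have "w i * (z i i - d i) = \<bar>z i i - d i\<bar>"
          by (auto simp: w_def sgn_if)
        moreover have "\<rho> ^ 3 \<le> \<rho> ^ 1" using \<rho> by (intro power_decreasing) auto
        ultimately show "ip K v \<delta> + w i * \<delta> i + \<rho> ^ 3 / 256 \<le> ip K v (z i) + w i * z i i"
          using 1 \<open>0 \<le> ip K v (z i)\<close> z[OF i] \<rho> by (simp add: algebra_simps)
      qed
    qed
    \<comment> \<open>The claim is weaker than \<rho>^3 / 256: the squared norm is at most 1, and
      272 exceeds 256.\<close>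
    moreover have "sqnorm K d * \<rho> ^ 3 / 272 \<le> \<rho> ^ 3 / 256"
      using mult_right_mono[OF sq_le[OF d(1)], of "\<rho> ^ 3"] \<rho> by simp
    ultimately show ?thesis unfolding \<rho>_def[symmetric] sup by simp
  qed
qed

text \<open>Here \<open>S\<close> is the half space \<open>\<delta> 1 \<le> 1/2\<close>, and \<open>v\<close> is a small multiple of the first unit vector.\<close>

lemma kappa_ge_coordinate_max:
  "(max (Min ((\<lambda>j. SUP \<delta>\<in>M. \<delta> j) ` {1..K}) - 1 / 2) 0) ^ 2 \<le> kappa K M"
proof -
  define m where "m = Min ((\<lambda>j. SUP \<delta>\<in>M. \<delta> j) ` {1..K})"
  have "\<exists>x\<in>M. m \<le> x j" if "j \<in> {1..K}" for j
  proof -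
    obtain x where "x \<in> M" "(SUP \<delta>\<in>M. \<delta> j) = x j"
      using coordinate_attained[of j] by metis
    moreover have "m \<le> (SUP \<delta>\<in>M. \<delta> j)"
      using that by (auto simp: m_def)
    ultimately show ?thesis by force
  qed
  then obtain x where x: "\<And>j. j \<in> {1..K} \<Longrightarrow> x j \<in> M \<and> m \<le> x j j" by metis
  have 1: "1 \<in> {1..K}" and 2: "2 \<in> {1..K}" using K by auto
  have M_bounds: "0 \<le> \<delta> j" "\<delta> j \<le> 1" if "\<delta> \<in> M" for \<delta> j
    using simplexK_bounds that M by blast+
  show ?thesis
  proof (cases "m \<le> 1 / 2")
    case True
    then show ?thesis unfolding m_def[symmetric] using kappa_nonneg by simp
  next
    case False
    define \<beta> where "\<beta> = m - 1 / 2"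
    have "m \<le> 1" using x[OF 1] M_bounds[of "x 1" 1] by auto
    with False have \<beta>: "0 < \<beta>" "\<beta> \<le> 1 / 2" by (auto simp: \<beta>_def)
    \<comment> \<open>The gap for v is \<beta> times m - 1/2, that is \<beta>^2. The gaps after the
      shift will be \<beta> (1 - \<beta>) for arm 1 and \<beta> / 2 for the others, and this
      inequality brings them down to \<beta>^2.\<close>
    have sq: "\<beta>\<^sup>2 \<le> \<beta> / 2" using \<beta> by (simp add: power2_eq_square mult_left_le)
    define S where "S = {\<delta>\<in>M. \<delta> 1 \<le> 1 / 2}"
    define v :: "nat \<Rightarrow> real" where "v i = (if i = 1 then \<beta> else 0)" for i
    \<comment> \<open>For arm 1 the sign -1 overturns v, so a small first coordinate is best and x 2
      beats the complement of S. For another arm i, mass above 1/2 on arm 1 leaves less than 1/2 for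
      \<delta> i, while x i has at least m there.\<close>
    define w :: "nat \<Rightarrow> real" where "w i = (if i = 1 then - 1 else 1)" for i
    have ip_v: "ip K v \<delta> = \<beta> * \<delta> 1" for \<delta>
    proof -
      have "ip K v \<delta> = (\<Sum>i\<in>{1..K}. if i = 1 then \<beta> * \<delta> 1 else 0)"
        unfolding ip_def v_def by (intro sum.cong) auto
      then show ?thesis using 1 by simp
    qed
    have x21: "x 2 1 \<le> 1 - m"
      using simplexK_pair_le[of "x 2" K 1 2] x[OF 2] M 1 2 by force
    have "\<beta>\<^sup>2 \<le> kappa K M"
    proof (rule kappa_geI[where S=S and v=v and w=w and x="x 1"])
      have "closed S"
        unfolding S_def using M(2)
        by (intro closed_Collect_conj[OF _ closed_Collect_le, of "\<lambda>\<delta>. \<delta> \<in> M", simplified] continuous_intros)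
      then show "S \<in> sets borel" by auto
      have "x 2 \<in> S" using x[OF 2] x21 False by (auto simp: S_def)
      then show "S \<noteq> {}" by auto
      have "x 1 \<notin> S" using x[OF 1] False by (auto simp: S_def)
      then show "S \<subset> M" using x[OF 1] by (auto simp: S_def)
      show "\<bar>v i\<bar> \<le> 1 \<and> \<bar>w i\<bar> \<le> 1" if "i \<in> {1..K}" for i
        using \<beta> by (auto simp: v_def w_def)
      show "x 1 \<in> M" using x[OF 1] by auto
      show "ip K v \<delta> + \<beta>\<^sup>2 \<le> ip K v (x 1)" if "\<delta> \<in> S" for \<delta>
      proof -
        have "\<beta> * (\<delta> 1 + \<beta>) \<le> \<beta> * x 1 1"
          using \<beta> that x[OF 1] by (intro mult_left_mono) (auto simp: S_def \<beta>_def)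
        then show ?thesis by (simp add: ip_v algebra_simps power2_eq_square)
      qed
      show "\<exists>z\<in>M. \<forall>\<delta>\<in>M - S. ip K v \<delta> + w i * \<delta> i + \<beta>\<^sup>2 \<le> ip K v z + w i * z i"
        if i: "i \<in> {1..K}" for i
      proof (cases "i = 1")
        case True
        show ?thesis
        proof (intro bexI ballI)
          show "x 2 \<in> M" using x[OF 2] by auto
          fix \<delta> assume "\<delta> \<in> M - S"
          then have "\<beta> \<le> \<delta> 1 - x 2 1" using x21 by (auto simp: S_def \<beta>_def)
          then have "(1 - \<beta>) * \<beta> \<le> (1 - \<beta>) * (\<delta> 1 - x 2 1)"
            using \<beta> by (intro mult_left_mono) auto
          then show "ip K v \<delta> + w i * \<delta> i + \<beta>\<^sup>2 \<le> ip K v (x 2) + w i * x 2 i"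
            using True sq by (simp add: ip_v w_def algebra_simps power2_eq_square)
        qed
      next
        case False
        show ?thesis
        proof (intro bexI ballI)
          show "x i \<in> M" using x[OF i] by auto
          fix \<delta> assume \<delta>: "\<delta> \<in> M - S"
          have "\<delta> 1 + \<delta> i \<le> 1"
            using simplexK_pair_le[of \<delta> K 1 i] \<delta> M 1 i False by auto
          moreover have "(1 - \<beta>) * (1 / 2) \<le> (1 - \<beta>) * \<delta> 1"
            using \<beta> \<delta> by (intro mult_left_mono) (auto simp: S_def)
          moreover have "0 \<le> \<beta> * x i 1" using \<beta> M_bounds[of "x i" 1] x[OF i] by auto
          moreover have "m \<le> x i i" using x[OF i] by auto
          ultimately show "ip K v \<delta> + w i * \<delta> i + \<beta>\<^sup>2 \<le> ip K v (x i) + w i * x i i"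
            using False sq by (simp add: ip_v w_def \<beta>_def algebra_simps)
        qed
      qed
    qed
    then show ?thesis unfolding m_def[symmetric] \<beta>_def[symmetric] using \<beta> by simp
  qed
qed

end

subsection \<open>Likelihood ratios of observed histories\<close>

text \<open>Causality of the history: product integrals can be unfolded one round at a time with the
  past frozen.\<close>

lemma hist_upd: "t < s \<Longrightarrow> hist pol n ((\<omega>)(s := q)) t = hist pol n \<omega> t"
  by (induction t) (auto simp: Let_def)

text \<open>For a density ratio 1 + x the linear part averages to zero, so the mean logarithm is
  bounded below by a multiple of the squared perturbation.\<close>

lemma ln_one_plus_ge: "x - 2 * x\<^sup>2 \<le> ln (1 + x)" if "\<bar>x\<bar> \<le> 1 / 2" for x :: real
  using abs_ln_one_plus_x_minus_x_bound[OF that] by linarith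

text \<open>This takes the place of the Bretagnolle-Huber inequality: the left side is linear in \<open>ln x\<close> and
  \<open>x\<close>, so for a likelihood ratio only its mean and a lower bound for its mean logarithm matter.\<close>

lemma four_min_ge:
  assumes "0 < x" shows "7 / 4 + ln x - x / 4 \<le> 4 * min 1 (x::real)"
proof (cases "1 \<le> x")
  case True
  \<comment> \<open>Tangents of ln: at 4 the slope is 1/4, which cancels x / 4. Below 1 the tangent
    at 1/4 has slope 4, and its constant term is at most -7/4.\<close>
  have "ln x = ln (x / 4) + ln 4" using assms by (simp add: ln_div)
  moreover have "ln (x / 4) \<le> x / 4 - 1" "ln 4 \<le> 4 - (1::real)"
    using assms by (intro ln_le_minus_one; simp)+
  ultimately show ?thesis using True by simp
next
  case False
  have "ln (4 * x) = ln 4 + ln x" using assms by (simp add: ln_mult)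
  moreover have "ln (4 * x) \<le> 4 * x - 1"
    using assms by (intro ln_le_minus_one) simp
  moreover have "- ln 4 \<le> 1 / 4 - (1::real)"
    using ln_le_minus_one[of "1 / 4"] by (simp add: ln_div)
  ultimately show ?thesis using False assms by simp
qed

text \<open>Collects what does not depend on the outcome laws, so that \<open>arm\<close> and
  \<open>extend\<close> are the same functions in the two instances that are compared.\<close>

locale sampling_policy =
  fixes K n :: nat
    and pol :: "nat \<Rightarrow> nat \<Rightarrow> (nat \<Rightarrow> real \<times> real) \<times> real \<Rightarrow> nat"
    and PG :: "real measure"
  assumes pol: "\<And>t. t \<in> {1..n} \<Longrightarrow>
      pol n t \<in> (PiM {1..<t} (\<lambda>_. borel) \<Otimes>\<^sub>M borel) \<rightarrow>\<^sub>M count_space {1..K}"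
    and PG: "prob_space PG" "sets PG = sets borel"
begin

declare One_nat_def [simp del] \<comment> \<open>otherwise \<open>{1..n}\<close> is rewritten to \<open>{Suc 0..n}\<close>\<close>

definition arm :: "nat \<Rightarrow> (nat \<Rightarrow> (nat \<Rightarrow> real) \<times> real) \<Rightarrow> nat" where
  "arm t \<omega> = pol n t (hist pol n \<omega> (t - 1), snd (\<omega> t))"

text \<open>One round as a map of the past h and the fresh draw q, so that h can be held fixed while
  q is integrated.\<close>

definition extend :: "nat \<Rightarrow> (nat \<Rightarrow> real \<times> real) \<Rightarrow> (nat \<Rightarrow> real) \<times> real \<Rightarrow> nat \<Rightarrow> real \<times> real" where
  "extend t h q = h(t := (fst q (pol n t (h, snd q)), snd q))"

lemma hist_Suc: "hist pol n \<omega> (Suc t) = extend (Suc t) (hist pol n \<omega> t) (\<omega> (Suc t))"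
  by (simp add: extend_def Let_def)

end

section \<open>Measurability and independence under adaptive sampling\<close>

locale bandit = sampling_policy +
  fixes \<mu> :: "nat \<Rightarrow> real measure"
  assumes prob_space_arm: "\<And>j. prob_space (\<mu> j)"
    and sets_arm: "\<And>j. sets (\<mu> j) = sets borel"
begin

declare sets_arm [measurable_cong, simp]

lemma measurable_outcome:
  "j \<in> {1..K} \<Longrightarrow> (\<lambda>y. y j) \<in> borel_measurable (PiM {1..K} \<mu>)"
  using measurable_component_singleton[of j "{1..K}" \<mu>]
  by (simp only: measurable_cong_sets[OF refl sets_arm])

lemma sets_PG [measurable_cong, simp]: "sets PG = sets borel"
  by (rule PG)

definition Q :: "((nat \<Rightarrow> real) \<times> real) measure" where
  "Q = PiM {1..K} \<mu> \<Otimes>\<^sub>M PG"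

lemma sets_Q [measurable_cong]: "sets Q = sets (PiM {1..K} (\<lambda>_. borel) \<Otimes>\<^sub>M borel)"
  unfolding Q_def by (intro sets_pair_measure_cong sets_PiM_cong PG refl sets_arm)

sublocale arms: product_prob_space \<mu> "{1..K}"
  by (simp add: product_prob_space_def product_prob_space_axioms_def product_sigma_finite_def
      prob_space_arm prob_space_imp_sigma_finite)

lemma prob_space_Q: "prob_space Q"
proof -
  interpret PG: prob_space PG by (rule PG)
  interpret pair_prob_space "PiM {1..K} \<mu>" PG ..
  show ?thesis unfolding Q_def by unfold_locales
qed

sublocale rounds: product_prob_space "\<lambda>_::nat. Q" "{1..Suc n}"
  by (simp add: product_prob_space_def product_prob_space_axioms_def product_sigma_finite_def
      prob_space_Q prob_space_imp_sigma_finite)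

abbreviation P :: "(nat \<Rightarrow> (nat \<Rightarrow> real) \<times> real) measure" where
  "P \<equiv> PiM {1..Suc n} (\<lambda>_. Q)"

lemma nn_integral_outcome:
  assumes j: "j \<in> {1..K}" and \<phi> [measurable]: "\<phi> \<in> borel_measurable borel"
  shows "(\<integral>\<^sup>+y. \<phi> (y j) \<partial>PiM {1..K} \<mu>) = (\<integral>\<^sup>+z. \<phi> z \<partial>\<mu> j)"
proof -
  have "(\<integral>\<^sup>+z. \<phi> z \<partial>\<mu> j) = (\<integral>\<^sup>+z. \<phi> z \<partial>distr (PiM {1..K} \<mu>) (\<mu> j) (\<lambda>\<omega>. \<omega> j))"
    by (subst distr_PiM_component) (use j prob_space_arm in auto)
  also have "\<dots> = (\<integral>\<^sup>+y. \<phi> (y j) \<partial>PiM {1..K} \<mu>)"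
    by (rule nn_integral_distr[OF measurable_component_singleton[OF j]]) measurable
  finally show ?thesis ..
qed

text \<open>The outcomes form the inner integral: with the past and g fixed, the pulled arm is fixed
  too, and a single marginal remains.\<close>

lemma nn_integral_Q:
  assumes "\<phi> \<in> borel_measurable Q"
  shows "(\<integral>\<^sup>+q. \<phi> q \<partial>Q) = (\<integral>\<^sup>+g. \<integral>\<^sup>+y. \<phi> (y, g) \<partial>PiM {1..K} \<mu> \<partial>PG)"
proof -
  interpret PG: prob_space PG by (rule PG)
  interpret pair_sigma_finite "PiM {1..K} \<mu>" PG ..
  show ?thesis using assms unfolding Q_def by (intro nn_integral_snd[symmetric])
qed

lemma measurable_extend [measurable]:
  assumes t: "t \<in> {1..n}"
  shows "(\<lambda>(h, q). extend t h q) \<in> PiM {1..<t} (\<lambda>_. borel) \<Otimes>\<^sub>M Q \<rightarrow>\<^sub>M PiM {1..t} (\<lambda>_. borel)"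
proof -
  note [measurable] = pol[OF t]
  \<comment> \<open>The coordinate that is read is itself random; it takes finitely many values, so
    measurability follows by splitting over them.\<close>
  have *: "(\<lambda>x. fst (snd x) (pol n t (fst x, snd (snd x)))) \<in>
      borel_measurable (PiM {1..<t} (\<lambda>_. borel) \<Otimes>\<^sub>M Q)"
    by (rule measurable_compose_countable'[where I="{1..K}"]) measurable
  have "{1..t} = insert t {1..<t}" using t by auto
  then show ?thesis
    unfolding extend_def split_beta'
    by (intro measurable_fun_upd) (use * in \<open>auto simp: borel_prod[symmetric]\<close>)
qed

text \<open>J is arbitrary because the history is read on several index sets: all rounds, the first
  t rounds, and all rounds but one.\<close>

lemma measurable_hist:
  "t \<le> n \<Longrightarrow> {1..t} \<subseteq> J \<Longrightarrow>
    (\<lambda>\<omega>. hist pol n \<omega> t) \<in> PiM J (\<lambda>_. Q) \<rightarrow>\<^sub>M PiM {1..t} (\<lambda>_. borel)"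
proof (induction t)
  case 0
  show ?case by (simp add: measurable_def space_PiM sets_PiM_empty flip: space_PiM)
next
  case (Suc t)
  have "{1..t} \<subseteq> J" using Suc.prems by (auto simp: subset_iff)
  then have [measurable]: "(\<lambda>\<omega>. hist pol n \<omega> t) \<in> PiM J (\<lambda>_. Q) \<rightarrow>\<^sub>M PiM {1..<Suc t} (\<lambda>_. borel)"
    using Suc by (simp add: atLeastLessThanSuc_atLeastAtMost)
  have [measurable]: "(\<lambda>\<omega>. \<omega> (Suc t)) \<in> PiM J (\<lambda>_. Q) \<rightarrow>\<^sub>M Q"
    using Suc by (intro measurable_component_singleton) auto
  have "Suc t \<in> {1..n}" using Suc by auto
  note [measurable] = measurable_extend[OF this]
  have "(\<lambda>\<omega>. (\<lambda>(h, q). extend (Suc t) h q) (hist pol n \<omega> t, \<omega> (Suc t)))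
      \<in> PiM J (\<lambda>_. Q) \<rightarrow>\<^sub>M PiM {1..Suc t} (\<lambda>_. borel)"
    by measurable
  then show ?case by (simp add: hist_Suc del: hist.simps)
qed

lemma measurable_arm:
  assumes t: "t \<in> {1..n}" and J: "{1..t} \<subseteq> J"
  shows "arm t \<in> PiM J (\<lambda>_. Q) \<rightarrow>\<^sub>M count_space {1..K}"
proof -
  have "{1..t - 1} = {1..<t}" using t by auto
  moreover have "{1..t - 1} \<subseteq> J" "t \<in> J" using J t by (auto simp: subset_iff)
  ultimately have [measurable]: "(\<lambda>\<omega>. hist pol n \<omega> (t - 1)) \<in> PiM J (\<lambda>_. Q) \<rightarrow>\<^sub>M PiM {1..<t} (\<lambda>_. borel)"
    using measurable_hist[of "t - 1" J] t by auto
  have [measurable]: "(\<lambda>\<omega>. \<omega> t) \<in> PiM J (\<lambda>_. Q) \<rightarrow>\<^sub>M Q"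
    using \<open>t \<in> J\<close> by (intro measurable_component_singleton)
  note [measurable] = pol[OF t]
  show ?thesis unfolding arm_def[abs_def] by measurable (rule \<open>t \<in> J\<close>)
qed

lemma measurable_observation:
  "(\<lambda>\<omega>. (hist pol n \<omega> n, snd (\<omega> (Suc n)))) \<in> P \<rightarrow>\<^sub>M PiM {1..n} (\<lambda>_. borel) \<Otimes>\<^sub>M borel"
proof -
  have [measurable]: "(\<lambda>\<omega>. hist pol n \<omega> n) \<in> P \<rightarrow>\<^sub>M PiM {1..n} (\<lambda>_. borel)"
    by (rule measurable_hist) auto
  have [measurable]: "(\<lambda>\<omega>. \<omega> (Suc n)) \<in> P \<rightarrow>\<^sub>M Q"
    by (intro measurable_component_singleton) auto
  show ?thesis by measurable
qed

lemma arm_in_range: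
  assumes t: "t \<in> {1..n}" and J: "{1..t} \<subseteq> J" and "\<omega> \<in> space (PiM J (\<lambda>_. Q))"
  shows "arm t \<omega> \<in> {1..K}"
  using measurable_space[OF measurable_arm[OF t J] assms(3)] by simp

text \<open>Pigeonhole: exactly one arm is pulled per round, so the expected numbers of pulls of the
  K arms add up to n.\<close>

lemma ex_rarely_pulled_arm:
  assumes K: "0 < K"
  shows "\<exists>i\<in>{1..K}. (\<Sum>s\<in>{1..n}. \<integral>\<omega>. (if arm s \<omega> = i then 1 else 0) \<partial>P) \<le> real n / real K"
proof (rule ccontr)
  let ?p = "\<lambda>s i. \<integral>\<omega>. (if arm s \<omega> = i then 1 else 0 :: real) \<partial>P"
  assume "\<not> ?thesis"
  then have "(\<Sum>i\<in>{1..K}. real n / real K) < (\<Sum>i\<in>{1..K}. \<Sum>s\<in>{1..n}. ?p s i)"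
    using K by (intro sum_strict_mono) (auto simp: not_le)
  also have "\<dots> = (\<Sum>s\<in>{1..n}. \<Sum>i\<in>{1..K}. ?p s i)"
    by (rule sum.swap)
  also have "\<dots> = (\<Sum>s\<in>{1..n}. 1)"
  proof (rule sum.cong)
    fix s assume s: "s \<in> {1..n}"
    then have J: "{1..s} \<subseteq> {1..Suc n}" by auto
    note [measurable] = measurable_arm[OF s J]
    have "integrable P (\<lambda>\<omega>. if arm s \<omega> = i then 1 else 0 :: real)" for i
      by (rule rounds.P.integrable_const_bound[where B=1]) auto
    then have "(\<Sum>i\<in>{1..K}. ?p s i) = (\<integral>\<omega>. (\<Sum>i\<in>{1..K}. if arm s \<omega> = i then 1 else 0) \<partial>P)"
      by (intro Bochner_Integration.integral_sum[symmetric])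
    also have "\<dots> = (\<integral>\<omega>. 1 \<partial>P)"
      using arm_in_range[OF s J] by (intro Bochner_Integration.integral_cong) auto
    finally show "(\<Sum>i\<in>{1..K}. ?p s i) = 1"
      by (simp add: rounds.P.prob_space)
  qed auto
  finally show False using K by simp
qed

text \<open>Fubini with round t innermost: the other rounds fix the past, G_t then fixes the
  decision, and the outcome Y_t is independent of G_t under \<open>Q\<close>.\<close>

lemma nn_integral_chosen_arm:
  assumes t: "t \<in> {1..n}" and i: "i \<in> {1..K}" and g [measurable]: "g \<in> borel_measurable borel"
  shows "(\<integral>\<^sup>+\<omega>. indicator {\<omega>. arm t \<omega> = i} \<omega> * g (fst (\<omega> t) i) \<partial>P)
       = (\<integral>\<^sup>+\<omega>. indicator {\<omega>. arm t \<omega> = i} \<omega> \<partial>P) * (\<integral>\<^sup>+z. g z \<partial>\<mu> i)"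
proof -
  define J where "J = {1..Suc n} - {t}"
  have J: "finite J" "t \<notin> J" "{1..Suc n} = insert t J" "{1..t - 1} \<subseteq> J"
    using t by (auto simp: J_def)
  have arm_upd: "arm t ((\<omega>)(t := q)) = pol n t (hist pol n \<omega> (t - 1), snd q)" for \<omega> q
    using t by (simp add: arm_def hist_upd)
  have [measurable]: "arm t \<in> PiM (insert t J) (\<lambda>_. Q) \<rightarrow>\<^sub>M count_space {1..K}"
    using t by (intro measurable_arm[OF t]) (auto simp: J_def)
  have [measurable]: "(\<lambda>\<omega>. \<omega> t) \<in> PiM (insert t J) (\<lambda>_. Q) \<rightarrow>\<^sub>M Q"
    by (intro measurable_component_singleton) auto
  have "{1..t - 1} = {1..<t}" using t by auto
  then have hist_space: "hist pol n \<omega> (t - 1) \<in> space (PiM {1..<t} (\<lambda>_. borel))" if "\<omega> \<in> space (PiM J (\<lambda>_. Q))" for \<omega>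
    using measurable_space[OF measurable_hist[of "t - 1" J] that] J t by auto
  have inner: "(\<integral>\<^sup>+q. indicator {\<omega>. arm t \<omega> = i} ((\<omega>)(t := q)) * g (fst q i) \<partial>Q)
     = (\<integral>\<^sup>+q. indicator {\<omega>. arm t \<omega> = i} ((\<omega>)(t := q)) \<partial>Q) * (\<integral>\<^sup>+z. g z \<partial>\<mu> i)"
    if \<omega>: "\<omega> \<in> space (PiM J (\<lambda>_. Q))" for \<omega>
  proof -
    have [measurable]: "(\<lambda>g. pol n t (hist pol n \<omega> (t - 1), g)) \<in> borel \<rightarrow>\<^sub>M count_space {1..K}"
      using measurable_compose[OF measurable_Pair1'[OF hist_space[OF \<omega>]] pol[OF t]] by simp
    define b :: "real \<Rightarrow> ennreal" where "b x = (if pol n t (hist pol n \<omega> (t - 1), x) = i then 1 else 0)" for x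
    have [measurable]: "b \<in> borel_measurable borel" unfolding b_def[abs_def] by measurable
    have bPG: "b \<in> borel_measurable PG" by measurable
    note [measurable] = measurable_outcome[OF i]
    have ind: "indicator {\<omega>. arm t \<omega> = i} ((\<omega>)(t := q)) = b (snd q)" for q
      by (simp add: indicator_def arm_upd b_def)
    have "(\<integral>\<^sup>+q. b (snd q) * g (fst q i) \<partial>Q) = (\<integral>\<^sup>+x. \<integral>\<^sup>+y. b x * g (y i) \<partial>PiM {1..K} \<mu> \<partial>PG)"
      using i by (subst nn_integral_Q) simp_all
    also have "\<dots> = (\<integral>\<^sup>+x. b x * (\<integral>\<^sup>+z. g z \<partial>\<mu> i) \<partial>PG)"
      using i by (intro nn_integral_cong) (subst nn_integral_cmult, measurable, subst nn_integral_outcome, auto)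
    also have "\<dots> = (\<integral>\<^sup>+x. b x \<partial>PG) * (\<integral>\<^sup>+z. g z \<partial>\<mu> i)"
      by (rule nn_integral_multc[OF bPG])
    also have "(\<integral>\<^sup>+x. b x \<partial>PG) = (\<integral>\<^sup>+q. b (snd q) \<partial>Q)"
      by (subst nn_integral_Q) (simp_all add: arms.P.emeasure_space_1)
    finally show ?thesis unfolding ind .
  qed
  have "(\<lambda>(\<omega>, q). (\<omega>)(t := q)) \<in> PiM J (\<lambda>_. Q) \<Otimes>\<^sub>M Q \<rightarrow>\<^sub>M PiM (insert t J) (\<lambda>_. Q)"
    by (rule measurable_add_dim)
  then have [measurable]: "(\<lambda>x. (fst x)(t := snd x)) \<in> PiM J (\<lambda>_. Q) \<Otimes>\<^sub>M Q \<rightarrow>\<^sub>M PiM (insert t J) (\<lambda>_. Q)"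
    by (simp add: split_beta')
  have [measurable]: "(\<lambda>x. indicator {\<omega>. arm t \<omega> = i} ((fst x)(t := snd x)) :: ennreal)
      \<in> borel_measurable (PiM J (\<lambda>_. Q) \<Otimes>\<^sub>M Q)"
    unfolding indicator_def by measurable
  have [measurable]: "(\<lambda>\<omega>. indicator {\<omega>. arm t \<omega> = i} \<omega> :: ennreal) \<in> borel_measurable (PiM (insert t J) (\<lambda>_. Q))"
    unfolding indicator_def by measurable
  have [measurable]: "(\<lambda>\<omega>. g (fst (\<omega> t) i)) \<in> borel_measurable (PiM (insert t J) (\<lambda>_. Q))"
    using i by measurable
  have "(\<integral>\<^sup>+\<omega>. indicator {\<omega>. arm t \<omega> = i} \<omega> * g (fst (\<omega> t) i) \<partial>P)
      = (\<integral>\<^sup>+\<omega>. \<integral>\<^sup>+q. indicator {\<omega>. arm t \<omega> = i} ((\<omega>)(t := q)) * g (fst q i) \<partial>Q \<partial>PiM J (\<lambda>_. Q))"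
    unfolding J(3) by (subst rounds.product_nn_integral_insert[OF J(1,2)]) simp_all
  also have "\<dots> = (\<integral>\<^sup>+\<omega>. (\<integral>\<^sup>+q. indicator {\<omega>. arm t \<omega> = i} ((\<omega>)(t := q)) \<partial>Q) * (\<integral>\<^sup>+z. g z \<partial>\<mu> i) \<partial>PiM J (\<lambda>_. Q))"
    by (intro nn_integral_cong inner)
  also have "\<dots> = (\<integral>\<^sup>+\<omega>. \<integral>\<^sup>+q. indicator {\<omega>. arm t \<omega> = i} ((\<omega>)(t := q)) \<partial>Q \<partial>PiM J (\<lambda>_. Q)) * (\<integral>\<^sup>+z. g z \<partial>\<mu> i)"
    by (intro nn_integral_multc) (simp add: split_beta')
  also have "(\<integral>\<^sup>+\<omega>. \<integral>\<^sup>+q. indicator {\<omega>. arm t \<omega> = i} ((\<omega>)(t := q)) \<partial>Q \<partial>PiM J (\<lambda>_. Q))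
      = (\<integral>\<^sup>+\<omega>. indicator {\<omega>. arm t \<omega> = i} \<omega> \<partial>P)"
    unfolding J(3) by (subst rounds.product_nn_integral_insert[OF J(1,2)]) simp_all
  finally show ?thesis .
qed

end

section \<open>Change of measure for observed histories\<close>

locale perturbed_bandit =
  base: bandit K n pol PG \<mu> + alt: bandit K n pol PG \<mu>'
  for K n :: nat and pol PG \<mu> \<mu>' +
  fixes i :: nat and f :: "real \<Rightarrow> real" and \<eta> :: real
  assumes i: "i \<in> {1..K}"
    and other_arms: "\<And>j. j \<noteq> i \<Longrightarrow> \<mu>' j = \<mu> j"
    and f [measurable]: "f \<in> borel_measurable borel"
    and density_i: "\<mu>' i = density (\<mu> i) f"
    and f_bound: "\<And>z. \<bar>f z - 1\<bar> \<le> \<eta>"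
    and \<eta>: "\<eta> \<le> 1 / 2"
begin

definition ratio :: "nat \<Rightarrow> (nat \<Rightarrow> real \<times> real) \<Rightarrow> (nat \<Rightarrow> real) \<times> real \<Rightarrow> real" where
  "ratio t h q = (if pol n t (h, snd q) = i then f (fst q i) else 1)"

text \<open>Likelihood ratio of the observed history, alternative against base. It is not a density
  of \<open>alt.P\<close> with respect to \<open>base.P\<close>, which would carry a factor for arm
  i in every round; here only rounds that pull arm i contribute.\<close>

definition likelihood :: "nat \<Rightarrow> (nat \<Rightarrow> (nat \<Rightarrow> real) \<times> real) \<Rightarrow> real" where
  "likelihood t \<omega> = (\<Prod>s\<in>{1..t}. ratio s (hist pol n \<omega> (s - 1)) (\<omega> s))"

text \<open>The bound 1/2 on \<eta> keeps f - 1 in the range of \<open>ln_one_plus_ge\<close>; it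
  also bounds the likelihood for each number of rounds, which settles integrability.\<close>

lemma f_ge_half: "1 / 2 \<le> f z" and f_le: "f z \<le> 3 / 2"
  using f_bound[of z] \<eta> by linarith+

lemma ratio_bounds: "1 / 2 \<le> ratio t h q" "ratio t h q \<le> 3 / 2"
  using f_ge_half f_le by (auto simp: ratio_def)

lemma ratio_pos: "0 < ratio t h q"
  by (rule less_le_trans[OF _ ratio_bounds(1)]) simp

lemma likelihood_pos: "0 < likelihood t \<omega>"
  unfolding likelihood_def by (intro prod_pos) (simp add: ratio_pos)

lemma likelihood_le: "likelihood t \<omega> \<le> (3 / 2) ^ t"
proof -
  have "likelihood t \<omega> \<le> (\<Prod>s\<in>{1..t}. 3 / 2)"
    unfolding likelihood_def using ratio_bounds less_imp_le[OF ratio_pos]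
    by (intro prod_mono) auto
  then show ?thesis by simp
qed

lemma likelihood_Suc:
  "likelihood (Suc t) \<omega> = likelihood t \<omega> * ratio (Suc t) (hist pol n \<omega> t) (\<omega> (Suc t))"
  by (simp add: likelihood_def)

lemma likelihood_upd: "t < s \<Longrightarrow> likelihood t ((\<omega>)(s := q)) = likelihood t \<omega>"
  by (auto simp: likelihood_def hist_upd intro!: prod.cong)

lemma measurable_ratio:
  assumes t: "t \<in> {1..n}"
  shows "(\<lambda>x. ratio t (fst x) (snd x)) \<in> borel_measurable (PiM {1..<t} (\<lambda>_. borel) \<Otimes>\<^sub>M base.Q)"
proof -
  note [measurable] = base.pol[OF t]
  have [measurable]: "(\<lambda>x. fst (snd x) i) \<in> borel_measurable (PiM {1..<t} (\<lambda>_. borel) \<Otimes>\<^sub>M base.Q)"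
    using i by measurable
  show ?thesis unfolding ratio_def by measurable
qed

lemma measurable_likelihood:
  assumes t: "t \<le> n" and J: "{1..t} \<subseteq> J"
  shows "likelihood t \<in> borel_measurable (PiM J (\<lambda>_. base.Q))"
  unfolding likelihood_def[abs_def]
proof (rule borel_measurable_prod)
  fix s assume s: "s \<in> {1..t}"
  then have "s \<in> {1..n}" "s \<in> J" "{1..s - 1} \<subseteq> J" "{1..s - 1} = {1..<s}" "s - 1 \<le> n"
    using t J by (auto simp: subset_iff)
  then have [measurable]: "(\<lambda>\<omega>. hist pol n \<omega> (s - 1)) \<in> PiM J (\<lambda>_. base.Q) \<rightarrow>\<^sub>M PiM {1..<s} (\<lambda>_. borel)"
    using base.measurable_hist by metis
  have [measurable]: "(\<lambda>\<omega>. \<omega> s) \<in> PiM J (\<lambda>_. base.Q) \<rightarrow>\<^sub>M base.Q"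
    using \<open>s \<in> J\<close> by (rule measurable_component_singleton)
  have "(\<lambda>\<omega>. (hist pol n \<omega> (s - 1), \<omega> s)) \<in> PiM J (\<lambda>_. base.Q) \<rightarrow>\<^sub>M PiM {1..<s} (\<lambda>_. borel) \<Otimes>\<^sub>M base.Q"
    by (rule measurable_Pair) fact+
  from measurable_compose[OF this measurable_ratio[OF \<open>s \<in> {1..n}\<close>]]
  show "(\<lambda>\<omega>. ratio s (hist pol n \<omega> (s - 1)) (\<omega> s)) \<in> borel_measurable (PiM J (\<lambda>_. base.Q))"
    by simp
qed

text \<open>Only one coordinate is observed, so only its marginal matters, and this differs between
  the instances only when j = i.\<close>

lemma nn_integral_arm_alt:
  assumes j: "j \<in> {1..K}" and [measurable]: "\<psi> \<in> borel_measurable borel"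
  shows "(\<integral>\<^sup>+y. \<psi> (y j) \<partial>PiM {1..K} \<mu>')
       = (\<integral>\<^sup>+y. ennreal (if j = i then f (y i) else 1) * \<psi> (y j) \<partial>PiM {1..K} \<mu>)"
proof (cases "j = i")
  case True
  have "(\<integral>\<^sup>+y. \<psi> (y i) \<partial>PiM {1..K} \<mu>') = (\<integral>\<^sup>+z. ennreal (f z) * \<psi> z \<partial>\<mu> i)"
    using i by (simp add: alt.nn_integral_outcome density_i nn_integral_density)
  also have "\<dots> = (\<integral>\<^sup>+y. ennreal (f (y i)) * \<psi> (y i) \<partial>PiM {1..K} \<mu>)"
    using i by (subst base.nn_integral_outcome[where \<phi>="\<lambda>z. ennreal (f z) * \<psi> z"]) auto
  finally show ?thesis using True by simp
next
  case False
  then show ?thesis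
    using j by (simp add: alt.nn_integral_outcome base.nn_integral_outcome other_arms)
qed

lemma sets_Q_alt: "sets alt.Q = sets base.Q"
  by (simp add: base.sets_Q alt.sets_Q)

text \<open>One-round change of measure. For fixed h and g the policy has chosen one arm, so
  \<open>nn_integral_arm_alt\<close> applies under the outer integral over g.\<close>

lemma nn_integral_Q_alt:
  assumes t: "t \<in> {1..n}" and h: "h \<in> space (PiM {1..<t} (\<lambda>_. borel))"
    and \<phi> [measurable]: "\<phi> \<in> borel_measurable (PiM {1..t} (\<lambda>_. borel))"
  shows "(\<integral>\<^sup>+q. \<phi> (base.extend t h q) \<partial>alt.Q)
       = (\<integral>\<^sup>+q. ennreal (ratio t h q) * \<phi> (base.extend t h q) \<partial>base.Q)"
proof -
  have "(\<lambda>q. base.extend t h q) \<in> base.Q \<rightarrow>\<^sub>M PiM {1..t} (\<lambda>_. borel)"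
    using measurable_compose[OF measurable_Pair1'[OF h] base.measurable_extend[OF t]] by simp
  then have m [measurable]: "(\<lambda>q. \<phi> (base.extend t h q)) \<in> borel_measurable base.Q"
    by measurable
  then have m': "(\<lambda>q. \<phi> (base.extend t h q)) \<in> borel_measurable alt.Q"
    by (simp only: measurable_cong_sets[OF sets_Q_alt refl])
  have [measurable]: "(\<lambda>q. ratio t h q) \<in> borel_measurable base.Q"
    using measurable_compose[OF measurable_Pair1'[OF h] measurable_ratio[OF t]] by simp
  have "(\<integral>\<^sup>+y. \<phi> (base.extend t h (y, g)) \<partial>PiM {1..K} \<mu>')
      = (\<integral>\<^sup>+y. ennreal (ratio t h (y, g)) * \<phi> (base.extend t h (y, g)) \<partial>PiM {1..K} \<mu>)" for g
  proof -
    have j: "pol n t (h, g) \<in> {1..K}"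
      using measurable_space[OF base.pol[OF t], of "(h, g)"] h by (simp add: space_pair_measure)
    have "{1..t} = insert t {1..<t}" using t by auto
    then have [measurable]: "(\<lambda>z. h(t := (z, g))) \<in> borel \<rightarrow>\<^sub>M PiM {1..t} (\<lambda>_. borel)"
      using h by (intro measurable_fun_upd[where J="{1..<t}"]) (auto simp: borel_prod[symmetric])
    have "(\<lambda>z. \<phi> (h(t := (z, g)))) \<in> borel_measurable borel" by measurable
    from nn_integral_arm_alt[OF j this] show ?thesis
      unfolding ratio_def base.extend_def fst_conv snd_conv .
  qed
  then show ?thesis
    by (simp add: alt.nn_integral_Q[OF m'] base.nn_integral_Q)
qed

text \<open>Induction that integrates out the last round: the inner integral is a function of the
  shorter history, and the induction hypothesis is applied to that function. This is why \<phi> must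
  be arbitrary.\<close>

lemma nn_integral_history_alt:
  "t \<le> n \<Longrightarrow> \<phi> \<in> borel_measurable (PiM {1..t} (\<lambda>_. borel)) \<Longrightarrow>
    (\<integral>\<^sup>+\<omega>. \<phi> (hist pol n \<omega> t) \<partial>PiM {1..t} (\<lambda>_. alt.Q))
  = (\<integral>\<^sup>+\<omega>. ennreal (likelihood t \<omega>) * \<phi> (hist pol n \<omega> t) \<partial>PiM {1..t} (\<lambda>_. base.Q))"
proof (induction t arbitrary: \<phi>)
  case 0
  then show ?case by (simp add: likelihood_def PiM_empty)
next
  case (Suc t)
  have t: "Suc t \<in> {1..n}" using Suc.prems by auto
  have I: "finite {1..t}" "Suc t \<notin> {1..t}" "{1..Suc t} = insert (Suc t) {1..t}" by auto
  have lt: "{1..<Suc t} = {1..t}" by auto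
  note [measurable] = Suc.prems(2)
  have m: "(\<lambda>\<omega>. \<phi> (hist pol n \<omega> (Suc t))) \<in> borel_measurable (PiM (insert (Suc t) {1..t}) (\<lambda>_. base.Q))"
    unfolding I(3)[symmetric]
    by (rule measurable_compose[OF base.measurable_hist Suc.prems(2)]) (use Suc.prems in auto)
  have m': "(\<lambda>\<omega>. \<phi> (hist pol n \<omega> (Suc t))) \<in> borel_measurable (PiM (insert (Suc t) {1..t}) (\<lambda>_. alt.Q))"
    unfolding I(3)[symmetric]
    by (rule measurable_compose[OF alt.measurable_hist Suc.prems(2)]) (use Suc.prems in auto)
  have ml [measurable]: "likelihood (Suc t) \<in> borel_measurable (PiM (insert (Suc t) {1..t}) (\<lambda>_. base.Q))"
    using measurable_likelihood[of "Suc t" "{1..Suc t}"] Suc.prems(1) I(3) by simp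
  have hist_upd_Suc: "hist pol n ((\<omega>)(Suc t := q)) (Suc t) = base.extend (Suc t) (hist pol n \<omega> t) q" for \<omega> q
    by (simp add: base.hist_Suc hist_upd del: hist.simps)
  define \<psi> where "\<psi> h = (\<integral>\<^sup>+q. \<phi> (base.extend (Suc t) h q) \<partial>alt.Q)" for h
  have "(\<lambda>x. \<phi> (case x of (h, q) \<Rightarrow> base.extend (Suc t) h q)) \<in>
      borel_measurable (PiM {1..<Suc t} (\<lambda>_. borel) \<Otimes>\<^sub>M alt.Q)"
    by (rule measurable_compose[OF alt.measurable_extend[OF t] Suc.prems(2)])
  then have \<psi>: "\<psi> \<in> borel_measurable (PiM {1..t} (\<lambda>_. borel))"
    unfolding \<psi>_def[abs_def] lt
    by (intro sigma_finite_measure.borel_measurable_nn_integral[OF prob_space_imp_sigma_finite[OF alt.prob_space_Q]]) (simp add: split_beta')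
  have "(\<integral>\<^sup>+\<omega>. \<phi> (hist pol n \<omega> (Suc t)) \<partial>PiM {1..Suc t} (\<lambda>_. alt.Q))
      = (\<integral>\<^sup>+\<omega>. \<psi> (hist pol n \<omega> t) \<partial>PiM {1..t} (\<lambda>_. alt.Q))"
    unfolding I(3) \<psi>_def
    by (subst alt.rounds.product_nn_integral_insert[OF I(1,2) m']) (simp add: hist_upd_Suc del: hist.simps)
  also have "\<dots> = (\<integral>\<^sup>+\<omega>. ennreal (likelihood t \<omega>) * \<psi> (hist pol n \<omega> t) \<partial>PiM {1..t} (\<lambda>_. base.Q))"
    using Suc.IH[OF _ \<psi>] Suc.prems(1) by simp
  also have "\<dots> = (\<integral>\<^sup>+\<omega>. \<integral>\<^sup>+q. ennreal (likelihood (Suc t) ((\<omega>)(Suc t := q))) * \<phi> (hist pol n ((\<omega>)(Suc t := q)) (Suc t)) \<partial>base.Q \<partial>PiM {1..t} (\<lambda>_. base.Q))"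
  proof (rule nn_integral_cong)
    fix \<omega> assume \<omega>: "\<omega> \<in> space (PiM {1..t} (\<lambda>_. base.Q))"
    have h: "hist pol n \<omega> t \<in> space (PiM {1..<Suc t} (\<lambda>_. borel))"
      using measurable_space[OF base.measurable_hist[of t "{1..t}"] \<omega>] Suc.prems(1) by (simp add: lt)
    have "(\<lambda>q. base.extend (Suc t) (hist pol n \<omega> t) q) \<in> base.Q \<rightarrow>\<^sub>M PiM {1..Suc t} (\<lambda>_. borel)"
      using measurable_compose[OF measurable_Pair1'[OF h] base.measurable_extend[OF t]] by simp
    then have [measurable]: "(\<lambda>q. \<phi> (base.extend (Suc t) (hist pol n \<omega> t) q)) \<in> borel_measurable base.Q"
      by measurable
    have [measurable]: "(\<lambda>q. ratio (Suc t) (hist pol n \<omega> t) q) \<in> borel_measurable base.Q"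
      using measurable_compose[OF measurable_Pair1'[OF h] measurable_ratio[OF t]] by simp
    have "ennreal (likelihood t \<omega>) * \<psi> (hist pol n \<omega> t)
        = (\<integral>\<^sup>+q. ennreal (likelihood t \<omega>) * (ennreal (ratio (Suc t) (hist pol n \<omega> t) q) * \<phi> (base.extend (Suc t) (hist pol n \<omega> t) q)) \<partial>base.Q)"
      unfolding \<psi>_def nn_integral_Q_alt[OF t h Suc.prems(2)] by (intro nn_integral_cmult[symmetric]) measurable
    also have "\<dots> = (\<integral>\<^sup>+q. ennreal (likelihood (Suc t) ((\<omega>)(Suc t := q))) * \<phi> (hist pol n ((\<omega>)(Suc t := q)) (Suc t)) \<partial>base.Q)"
      using less_imp_le[OF likelihood_pos] less_imp_le[OF ratio_pos]
      by (intro nn_integral_cong)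
        (simp add: hist_upd_Suc likelihood_Suc likelihood_upd hist_upd ennreal_mult mult.assoc del: hist.simps)
    finally show "ennreal (likelihood t \<omega>) * \<psi> (hist pol n \<omega> t) = \<dots>" .
  qed
  also have "\<dots> = (\<integral>\<^sup>+\<omega>. ennreal (likelihood (Suc t) \<omega>) * \<phi> (hist pol n \<omega> (Suc t)) \<partial>PiM {1..Suc t} (\<lambda>_. base.Q))"
    unfolding I(3)
    by (rule base.rounds.product_nn_integral_insert[OF I(1,2), symmetric])
      (intro borel_measurable_times_ennreal measurable_compose[OF ml measurable_ennreal] m)
  finally show ?case .
qed

abbreviation observation :: "(nat \<Rightarrow> (nat \<Rightarrow> real) \<times> real) \<Rightarrow> (nat \<Rightarrow> real \<times> real) \<times> real" where
  "observation \<omega> \<equiv> (hist pol n \<omega> n, snd (\<omega> (Suc n)))"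

text \<open>Round \<open>Suc n\<close> supplies only the randomization variable, whose law is the
  same in both instances, so the likelihood stops at n.\<close>

lemma nn_integral_observation_alt:
  assumes \<phi> [measurable]: "\<phi> \<in> borel_measurable (PiM {1..n} (\<lambda>_. borel) \<Otimes>\<^sub>M borel)"
  shows "(\<integral>\<^sup>+\<omega>. \<phi> (observation \<omega>) \<partial>alt.P)
       = (\<integral>\<^sup>+\<omega>. ennreal (likelihood n \<omega>) * \<phi> (observation \<omega>) \<partial>base.P)"
proof -
  interpret PG: prob_space PG by (rule base.PG)
  define \<psi> where "\<psi> h = (\<integral>\<^sup>+g. \<phi> (h, g) \<partial>PG)" for h
  have [measurable]: "\<psi> \<in> borel_measurable (PiM {1..n} (\<lambda>_. borel))"
    unfolding \<psi>_def[abs_def] by measurable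
  have I: "finite {1..n}" "Suc n \<notin> {1..n}" "{1..Suc n} = insert (Suc n) {1..n}" by auto
  have round: "(\<integral>\<^sup>+q. \<phi> (h, snd q) \<partial>base.Q) = \<psi> h" "(\<integral>\<^sup>+q. \<phi> (h, snd q) \<partial>alt.Q) = \<psi> h"
    and mq: "(\<lambda>q. \<phi> (h, snd q)) \<in> borel_measurable base.Q"
    if h: "h \<in> space (PiM {1..n} (\<lambda>_. borel))" for h
  proof -
    have [measurable]: "(\<lambda>g. \<phi> (h, g)) \<in> borel_measurable borel"
      using measurable_compose[OF measurable_Pair1'[OF h] \<phi>] .
    show "(\<integral>\<^sup>+q. \<phi> (h, snd q) \<partial>base.Q) = \<psi> h"
      unfolding \<psi>_def by (subst base.nn_integral_Q) (simp_all add: base.arms.P.emeasure_space_1)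
    show "(\<integral>\<^sup>+q. \<phi> (h, snd q) \<partial>alt.Q) = \<psi> h"
      unfolding \<psi>_def by (subst alt.nn_integral_Q) (simp_all add: alt.arms.P.emeasure_space_1)
    show "(\<lambda>q. \<phi> (h, snd q)) \<in> borel_measurable base.Q" by measurable
  qed
  have "(\<integral>\<^sup>+\<omega>. \<phi> (observation \<omega>) \<partial>alt.P) = (\<integral>\<^sup>+\<omega>. \<psi> (hist pol n \<omega> n) \<partial>PiM {1..n} (\<lambda>_. alt.Q))"
  proof -
    have "(\<lambda>\<omega>. \<phi> (observation \<omega>)) \<in> borel_measurable (PiM (insert (Suc n) {1..n}) (\<lambda>_. alt.Q))"
      unfolding I(3)[symmetric] by (rule measurable_compose[OF alt.measurable_observation \<phi>])
    then show ?thesis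
      unfolding I(3) using measurable_space[OF alt.measurable_hist[of n "{1..n}"]]
      by (subst alt.rounds.product_nn_integral_insert[OF I(1,2)])
        (auto simp: hist_upd round intro!: nn_integral_cong)
  qed
  also have "\<dots> = (\<integral>\<^sup>+\<omega>. ennreal (likelihood n \<omega>) * \<psi> (hist pol n \<omega> n) \<partial>PiM {1..n} (\<lambda>_. base.Q))"
    by (rule nn_integral_history_alt) auto
  also have "\<dots> = (\<integral>\<^sup>+\<omega>. \<integral>\<^sup>+q. ennreal (likelihood n ((\<omega>)(Suc n := q))) * \<phi> (observation ((\<omega>)(Suc n := q))) \<partial>base.Q \<partial>PiM {1..n} (\<lambda>_. base.Q))"
  proof (rule nn_integral_cong)
    fix \<omega> assume "\<omega> \<in> space (PiM {1..n} (\<lambda>_. base.Q))"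
    then have h: "hist pol n \<omega> n \<in> space (PiM {1..n} (\<lambda>_. borel))"
      using measurable_space[OF base.measurable_hist[of n "{1..n}"]] by blast
    show "ennreal (likelihood n \<omega>) * \<psi> (hist pol n \<omega> n) =
      (\<integral>\<^sup>+q. ennreal (likelihood n ((\<omega>)(Suc n := q))) * \<phi> (observation ((\<omega>)(Suc n := q))) \<partial>base.Q)"
      using mq[OF h] by (simp add: likelihood_upd hist_upd nn_integral_cmult round(1)[OF h])
  qed
  also have "\<dots> = (\<integral>\<^sup>+\<omega>. ennreal (likelihood n \<omega>) * \<phi> (observation \<omega>) \<partial>base.P)"
  proof -
    have "(\<lambda>\<omega>. \<phi> (observation \<omega>)) \<in> borel_measurable (PiM (insert (Suc n) {1..n}) (\<lambda>_. base.Q))"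
      unfolding I(3)[symmetric] by (rule measurable_compose[OF base.measurable_observation \<phi>])
    moreover have "likelihood n \<in> borel_measurable (PiM (insert (Suc n) {1..n}) (\<lambda>_. base.Q))"
      by (rule measurable_likelihood) auto
    ultimately show ?thesis
      unfolding I(3) by (subst base.rounds.product_nn_integral_insert[OF I(1,2)]) auto
  qed
  finally show ?thesis .
qed

section \<open>Mean logarithm of the likelihood and the testing bound\<close>

definition pulled :: "nat \<Rightarrow> (nat \<Rightarrow> (nat \<Rightarrow> real) \<times> real) \<Rightarrow> real" where
  "pulled s \<omega> = (if base.arm s \<omega> = i then 1 else 0)"

text \<open>The relative perturbation of the density of arm i, with mean zero under
  \<open>\<mu> i\<close>. It is recorded in every round; the factor \<open>pulled\<close> selects
  the rounds that count.\<close>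

definition dev :: "nat \<Rightarrow> (nat \<Rightarrow> (nat \<Rightarrow> real) \<times> real) \<Rightarrow> real" where
  "dev s \<omega> = f (fst (\<omega> s) i) - 1"

lemma measurable_pulled [measurable]:
  assumes "s \<in> {1..n}" shows "pulled s \<in> borel_measurable base.P"
proof -
  have [measurable]: "base.arm s \<in> base.P \<rightarrow>\<^sub>M count_space {1..K}"
    using assms by (intro base.measurable_arm) auto
  show ?thesis unfolding pulled_def[abs_def] by measurable
qed

lemma measurable_dev [measurable]:
  assumes "s \<in> {1..n}" shows "dev s \<in> borel_measurable base.P"
proof -
  have "(\<lambda>\<omega>. \<omega> s) \<in> base.P \<rightarrow>\<^sub>M base.Q"
    using assms by (intro measurable_component_singleton) auto
  moreover have "(\<lambda>q. f (fst q i) - 1) \<in> borel_measurable base.Q"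
    using i by measurable
  ultimately show ?thesis unfolding dev_def[abs_def] by (rule measurable_compose)
qed

lemma dev_bound: "\<bar>dev s \<omega>\<bar> \<le> \<eta>"
  by (simp add: dev_def f_bound)

lemma integrable_pulled_dev:
  assumes s: "s \<in> {1..n}"
  shows "integrable base.P (pulled s)"
    "integrable base.P (\<lambda>\<omega>. pulled s \<omega> * dev s \<omega>)"
    "integrable base.P (\<lambda>\<omega>. pulled s \<omega> * (dev s \<omega>)\<^sup>2)"
proof -
  note [measurable] = measurable_pulled[OF s] measurable_dev[OF s]
  have d: "\<bar>dev s \<omega>\<bar> \<le> 1" for \<omega> using dev_bound[of s \<omega>] \<eta> by simp
  have d2: "(dev s \<omega>)\<^sup>2 \<le> 1" for \<omega> using d[of \<omega>] by (simp add: abs_square_le_1)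
  show "integrable base.P (pulled s)"
    by (rule base.rounds.P.integrable_const_bound[where B=1], rule AE_I2) (simp add: pulled_def, measurable)
  show "integrable base.P (\<lambda>\<omega>. pulled s \<omega> * dev s \<omega>)"
    by (rule base.rounds.P.integrable_const_bound[where B=1], rule AE_I2) (simp add: pulled_def d, measurable)
  show "integrable base.P (\<lambda>\<omega>. pulled s \<omega> * (dev s \<omega>)\<^sup>2)"
    by (rule base.rounds.P.integrable_const_bound[where B=1], rule AE_I2) (simp add: pulled_def d2, measurable)
qed

text \<open>The outcome of the arm pulled in round \<open>s\<close> is independent of the decision to pull it.\<close>

lemma integral_pulled_dev:
  assumes s: "s \<in> {1..n}"
  shows "(\<integral>\<omega>. pulled s \<omega> * dev s \<omega> \<partial>base.P) = 0"
proof -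
  note [measurable] = measurable_pulled[OF s] measurable_dev[OF s]
  \<comment> \<open>The sum of \<open>dev\<close> and 1 is f, which is nonnegative, so
    \<open>nn_integral_chosen_arm\<close> applies to it; f has mean 1 because
    \<open>\<mu>' i\<close> is a probability measure.\<close>
  have ip: "integrable base.P (\<lambda>\<omega>. pulled s \<omega> * (dev s \<omega> + 1))"
    using integrable_pulled_dev[OF s] by (simp add: distrib_left)
  have "space (\<mu>' i) = UNIV"
    using sets_eq_imp_space_eq[OF alt.sets_arm[of i]] by simp
  then have "emeasure (density (\<mu> i) f) UNIV = 1"
    using prob_space.emeasure_space_1[OF alt.prob_space_arm[of i]] by (simp add: density_i)
  then have f1: "(\<integral>\<^sup>+z. ennreal (f z) \<partial>\<mu> i) = 1"
    by (simp add: emeasure_density)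
  have ind: "ennreal (pulled s \<omega>) = indicator {\<omega>. base.arm s \<omega> = i} \<omega>" for \<omega>
    by (simp add: pulled_def indicator_def)
  have "(\<integral>\<^sup>+\<omega>. ennreal (pulled s \<omega> * (dev s \<omega> + 1)) \<partial>base.P)
      = (\<integral>\<^sup>+\<omega>. indicator {\<omega>. base.arm s \<omega> = i} \<omega> * ennreal (f (fst (\<omega> s) i)) \<partial>base.P)"
    by (intro nn_integral_cong) (auto simp: pulled_def dev_def)
  also have "\<dots> = (\<integral>\<^sup>+\<omega>. indicator {\<omega>. base.arm s \<omega> = i} \<omega> \<partial>base.P)"
    by (subst base.nn_integral_chosen_arm[OF s i]) (auto simp: f1)
  also have "\<dots> = (\<integral>\<^sup>+\<omega>. ennreal (pulled s \<omega>) \<partial>base.P)"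
    by (simp add: ind)
  finally have "(\<integral>\<^sup>+\<omega>. ennreal (pulled s \<omega> * (dev s \<omega> + 1)) \<partial>base.P) = (\<integral>\<^sup>+\<omega>. ennreal (pulled s \<omega>) \<partial>base.P)" .
  moreover have nonneg: "0 \<le> pulled s \<omega> * (dev s \<omega> + 1)" "0 \<le> pulled s \<omega>" for \<omega>
    using order.trans[OF _ f_ge_half, of 0] by (auto simp: pulled_def dev_def)
  ultimately have "ennreal (\<integral>\<omega>. pulled s \<omega> * (dev s \<omega> + 1) \<partial>base.P) = ennreal (\<integral>\<omega>. pulled s \<omega> \<partial>base.P)"
    by (simp add: nn_integral_eq_integral ip integrable_pulled_dev[OF s])
  then have "(\<integral>\<omega>. pulled s \<omega> * (dev s \<omega> + 1) \<partial>base.P) = (\<integral>\<omega>. pulled s \<omega> \<partial>base.P)"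
    using nonneg by (subst (asm) ennreal_inj) (auto intro!: integral_nonneg_AE)
  then show ?thesis
    using integrable_pulled_dev[OF s] by (simp add: distrib_left)
qed

lemma ln_likelihood_ge:
  "(\<Sum>s\<in>{1..n}. pulled s \<omega> * dev s \<omega> - 2 * (pulled s \<omega> * (dev s \<omega>)\<^sup>2)) \<le> ln (likelihood n \<omega>)"
proof -
  have "ln (likelihood n \<omega>) = (\<Sum>s\<in>{1..n}. ln (ratio s (hist pol n \<omega> (s - 1)) (\<omega> s)))"
    unfolding likelihood_def
    by (intro ln_prod) (simp_all add: ratio_pos less_imp_neq[OF ratio_pos, THEN not_sym])
  moreover have "pulled s \<omega> * dev s \<omega> - 2 * (pulled s \<omega> * (dev s \<omega>)\<^sup>2) \<le> ln (ratio s (hist pol n \<omega> (s - 1)) (\<omega> s))" for s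
    using ln_one_plus_ge[of "dev s \<omega>"] dev_bound[of s \<omega>] \<eta>
    by (auto simp: pulled_def ratio_def base.arm_def dev_def)
  ultimately show ?thesis by (simp add: sum_mono)
qed

text \<open>The two error probabilities add up to at least the base mean of min 1 L, L being the
  likelihood. The budget says that ln L has mean at least -1, and L has mean 1, so
  \<open>four_min_ge\<close> gives 7/4 - 1 - 1/4 = 1/2 for four times that mean.\<close>

lemma two_point_bound:
  assumes A: "A \<in> sets (PiM {1..n} (\<lambda>_. borel) \<Otimes>\<^sub>M borel)"
    and budget: "2 * \<eta>\<^sup>2 * (\<Sum>s\<in>{1..n}. \<integral>\<omega>. pulled s \<omega> \<partial>base.P) \<le> 1"
  shows "(1 / 8 :: real) \<le> (\<integral>\<omega>. indicator A (observation \<omega>) \<partial>base.P)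
               + (\<integral>\<omega>. 1 - indicator A (observation \<omega>) \<partial>alt.P)"
proof -
  let ?I = "\<lambda>\<omega>. indicator A (observation \<omega>) :: real" and ?L = "likelihood n"
  have mI [measurable]: "?I \<in> borel_measurable base.P"
    by (rule measurable_compose[OF base.measurable_observation borel_measurable_indicator[OF A]])
  have mI' [measurable]: "?I \<in> borel_measurable alt.P"
    by (rule measurable_compose[OF alt.measurable_observation borel_measurable_indicator[OF A]])
  have mL [measurable]: "?L \<in> borel_measurable base.P"
    by (rule measurable_likelihood) auto
  have L0: "0 \<le> ?L \<omega>" for \<omega> using likelihood_pos less_imp_le by blast
  have I_bounds: "\<bar>?I \<omega>\<bar> \<le> 1" "\<bar>1 - ?I \<omega>\<bar> \<le> 1" for \<omega>
    by (auto simp: indicator_def)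
  have iI: "integrable base.P ?I" "integrable alt.P (\<lambda>\<omega>. 1 - ?I \<omega>)"
    by (auto intro!: base.rounds.P.integrable_const_bound[where B=1]
        alt.rounds.P.integrable_const_bound[where B=1] I_bounds)
  have iL: "integrable base.P ?L"
    using likelihood_le L0 by (intro base.rounds.P.integrable_const_bound[where B="(3/2)^n"]) auto
  have iLI: "integrable base.P (\<lambda>\<omega>. ?L \<omega> * (1 - ?I \<omega>))"
  proof (rule base.rounds.P.integrable_const_bound[where B="(3/2)^n"], rule AE_I2)
    show "norm (?L \<omega> * (1 - ?I \<omega>)) \<le> (3/2)^n" for \<omega>
      using likelihood_le[of n \<omega>] L0[of \<omega>] by (simp add: indicator_def)
  qed measurable
  have change: "(\<integral>\<omega>. \<phi> (observation \<omega>) \<partial>alt.P) = (\<integral>\<omega>. ?L \<omega> * \<phi> (observation \<omega>) \<partial>base.P)"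
    if [measurable]: "\<phi> \<in> borel_measurable (PiM {1..n} (\<lambda>_. borel) \<Otimes>\<^sub>M borel)"
      and "\<And>x. 0 \<le> \<phi> x" for \<phi> :: "_ \<Rightarrow> real"
  proof -
    have "(\<lambda>\<omega>. \<phi> (observation \<omega>)) \<in> borel_measurable alt.P" "(\<lambda>\<omega>. \<phi> (observation \<omega>)) \<in> borel_measurable base.P"
      using measurable_compose[OF alt.measurable_observation that(1)]
        measurable_compose[OF base.measurable_observation that(1)] by auto
    then show ?thesis
      using nn_integral_observation_alt[of "\<lambda>x. ennreal (\<phi> x)"] that(2) L0
      by (subst (1 2) integral_eq_nn_integral) (auto simp: ennreal_mult)
  qed
  have L1: "(\<integral>\<omega>. ?L \<omega> \<partial>base.P) = 1"
    using change[of "\<lambda>_. 1"] by (simp add: alt.rounds.P.prob_space)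
  have alt_eq: "(\<integral>\<omega>. 1 - ?I \<omega> \<partial>alt.P) = (\<integral>\<omega>. ?L \<omega> * (1 - ?I \<omega>) \<partial>base.P)"
    using A by (intro change[of "\<lambda>x. 1 - indicator A x"]) (auto simp: indicator_def)
  let ?S = "\<lambda>\<omega>. \<Sum>s\<in>{1..n}. pulled s \<omega> * dev s \<omega> - 2 * (pulled s \<omega> * (dev s \<omega>)\<^sup>2)"
  have iS: "integrable base.P ?S"
    using integrable_pulled_dev by (intro Bochner_Integration.integrable_sum Bochner_Integration.integrable_diff integrable_mult_right) auto
  have "(\<Sum>s\<in>{1..n}. - (2 * \<eta>\<^sup>2 * (\<integral>\<omega>. pulled s \<omega> \<partial>base.P))) \<le> (\<integral>\<omega>. ?S \<omega> \<partial>base.P)"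
  proof -
    have sq: "(\<integral>\<omega>. pulled s \<omega> * (dev s \<omega>)\<^sup>2 \<partial>base.P) \<le> (\<integral>\<omega>. \<eta>\<^sup>2 * pulled s \<omega> \<partial>base.P)"
      if s: "s \<in> {1..n}" for s
    proof (rule integral_mono)
      show "pulled s \<omega> * (dev s \<omega>)\<^sup>2 \<le> \<eta>\<^sup>2 * pulled s \<omega>" for \<omega>
        using power_mono[OF dev_bound[of s \<omega>], of 2] by (simp add: pulled_def)
    qed (use integrable_pulled_dev[OF s] in auto)
    have "(\<integral>\<omega>. ?S \<omega> \<partial>base.P) = (\<Sum>s\<in>{1..n}. - (2 * (\<integral>\<omega>. pulled s \<omega> * (dev s \<omega>)\<^sup>2 \<partial>base.P)))"
      using integrable_pulled_dev
      by (subst Bochner_Integration.integral_sum)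
        (auto intro!: sum.cong simp: integral_pulled_dev)
    also have "\<dots> \<ge> (\<Sum>s\<in>{1..n}. - (2 * \<eta>\<^sup>2 * (\<integral>\<omega>. pulled s \<omega> \<partial>base.P)))"
      using sq by (intro sum_mono) auto
    finally show ?thesis .
  qed
  then have S: "- 1 \<le> (\<integral>\<omega>. ?S \<omega> \<partial>base.P)"
    using budget by (simp add: sum_negf sum_distrib_left)
  have "(\<integral>\<omega>. 7 / 4 + ?S \<omega> - ?L \<omega> / 4 \<partial>base.P) \<le> (\<integral>\<omega>. 4 * ?I \<omega> + 4 * (?L \<omega> * (1 - ?I \<omega>)) \<partial>base.P)"
  proof (rule integral_mono)
    fix \<omega>
    have "7 / 4 + ?S \<omega> - ?L \<omega> / 4 \<le> 4 * min 1 (?L \<omega>)"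
      using ln_likelihood_ge[of \<omega>] four_min_ge[OF likelihood_pos[of n \<omega>]] by linarith
    \<comment> \<open>Inside A the error counted is 1, outside it is the likelihood; either way it
      is at least their minimum.\<close>
    also have "\<dots> \<le> 4 * ?I \<omega> + 4 * (?L \<omega> * (1 - ?I \<omega>))"
      using L0[of \<omega>] by (auto simp: indicator_def)
    finally show "7 / 4 + ?S \<omega> - ?L \<omega> / 4 \<le> 4 * ?I \<omega> + 4 * (?L \<omega> * (1 - ?I \<omega>))" .
  qed (use iS iL iLI iI in auto)
  moreover have "(\<integral>\<omega>. 7 / 4 + ?S \<omega> - ?L \<omega> / 4 \<partial>base.P) = 7 / 4 + (\<integral>\<omega>. ?S \<omega> \<partial>base.P) - 1 / 4"
    using iS iL by (simp add: L1 base.rounds.P.prob_space)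
  moreover have "(\<integral>\<omega>. 4 * ?I \<omega> + 4 * (?L \<omega> * (1 - ?I \<omega>)) \<partial>base.P)
      = 4 * (\<integral>\<omega>. ?I \<omega> \<partial>base.P) + 4 * (\<integral>\<omega>. ?L \<omega> * (1 - ?I \<omega>) \<partial>base.P)"
    using iI iLI by simp
  ultimately show ?thesis using S unfolding alt_eq by linarith
qed

end

subsection \<open>Mixtures of two distributions\<close>

text \<open>The arm laws are built from mixed cdfs, so the mixture identity is first known on
  half-lines only. These are stable under intersection and generate the Borel sets.\<close>

lemma measure_mixture:
  assumes "real_distribution N" "real_distribution N1" "real_distribution N2"
    and cdf: "\<And>x. cdf N x = t * cdf N1 x + (1 - t) * cdf N2 x"
    and A: "A \<in> sets borel"
  shows "measure N A = t * measure N1 A + (1 - t) * measure N2 A"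
proof -
  interpret N: real_distribution N by fact
  interpret N1: real_distribution N1 by fact
  interpret N2: real_distribution N2 by fact
  have borel: "sets borel = sigma_sets UNIV (range (\<lambda>x::real. {..x}))"
    by (simp add: borel_eq_atMost image_def Setcompr_eq_image sets_measure_of)
  have "Int_stable (range (\<lambda>x::real. {..x}))" "range (\<lambda>x::real. {..x}) \<subseteq> Pow UNIV"
    by (auto simp: Int_stable_def)
  then show ?thesis using A[unfolded borel]
  proof (induction rule: sigma_sets_induct_disjoint)
    case (basic A)
    then show ?case using cdf by (auto simp: cdf_def)
  next
    case (compl A)
    then have "A \<in> sets borel" by (simp add: borel)
    then have "measure N (UNIV - A) = 1 - measure N A" "measure N1 (UNIV - A) = 1 - measure N1 A"
      "measure N2 (UNIV - A) = 1 - measure N2 A"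
      using N.prob_compl[of A] N1.prob_compl[of A] N2.prob_compl[of A] by simp_all
    then show ?case
      by (simp only: compl.IH) (simp add: algebra_simps)
  next
    case (union A)
    then have "range A \<subseteq> sets borel" by (simp add: borel)
    then have s1: "(\<lambda>i. measure N1 (A i)) sums measure N1 (\<Union>i. A i)"
      and s2: "(\<lambda>i. measure N2 (A i)) sums measure N2 (\<Union>i. A i)"
      and s: "(\<lambda>i. measure N (A i)) sums measure N (\<Union>i. A i)"
      using union(1) by (auto intro!: N.finite_measure_UNION N1.finite_measure_UNION N2.finite_measure_UNION
          simp del: union.IH)
    have "(\<lambda>i. measure N (A i)) sums (t * measure N1 (\<Union>i. A i) + (1 - t) * measure N2 (\<Union>i. A i))"
      unfolding union.IH by (intro sums_add sums_mult s1 s2)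
    with s show ?case by (rule sums_unique2)
  qed auto
qed

text \<open>The bound on sets gives absolute continuity. It passes to the Radon-Nikodym derivative
  by testing it on the set where the derivative violates the bound, which is thereby a null
  set.\<close>

lemma bounded_density_exists:
  assumes "real_distribution N" "real_distribution N'" and \<eta>: "0 \<le> \<eta>" "\<eta> \<le> 1"
    and close: "\<And>A. A \<in> sets borel \<Longrightarrow> \<bar>measure N' A - measure N A\<bar> \<le> \<eta> * measure N A"
  obtains f :: "real \<Rightarrow> real" where "f \<in> borel_measurable borel" "N' = density N f" "\<And>z. \<bar>f z - 1\<bar> \<le> \<eta>"
proof -
  interpret N: real_distribution N by fact
  interpret N': real_distribution N' by fact
  have ac: "absolutely_continuous N N'"
  proof -
    have "emeasure N' A = 0" if "A \<in> null_sets N" for A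
    proof -
      have "measure N A = 0" "A \<in> sets borel" using that by (auto simp: null_sets_def measure_def)
      then have "measure N' A = 0" using close[of A] measure_nonneg[of N' A] by simp
      then show ?thesis by (simp add: N'.emeasure_eq_measure)
    qed
    then show ?thesis by (auto simp: absolutely_continuous_def null_sets_def)
  qed
  obtain d where d [measurable]: "d \<in> borel_measurable N" and RN: "AE x in N. RN_deriv N N' x = ennreal (d x)"
    and d0: "\<And>x. 0 \<le> d x"
    using N.real_RN_deriv[OF N'.finite_measure_axioms ac] by auto
  have dens: "N' = density N d"
  proof -
    have "N' = density N (RN_deriv N N')"
      using N.density_RN_deriv[OF ac] by simp
    also have "\<dots> = density N d"
      using RN by (intro density_cong) auto
    finally show ?thesis .
  qed
  have "integrable (density N d) (\<lambda>_. 1 :: real)"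
    unfolding dens[symmetric] by simp
  then have int: "integrable N d"
    using d0 by (subst (asm) integrable_density) auto
  have set_int: "(\<integral>x. d x * indicator A x \<partial>N) = measure N' A" if A: "A \<in> sets borel" for A
  proof -
    have "(\<integral>x. (indicator A x :: real) \<partial>density N d) = (\<integral>x. d x *\<^sub>R indicator A x \<partial>N)"
      using A d0 by (intro integral_density) auto
    then show ?thesis using A unfolding dens[symmetric] by simp
  qed
  have int_ind: "integrable N (\<lambda>x. d x * indicator A x)" if "A \<in> sets borel" for A
    using integrable_mult_indicator[of A N d] that int by (simp add: mult.commute)
  have ind: "integrable N (indicator A :: real \<Rightarrow> real)" if "A \<in> sets borel" for A
    by (rule N.integrable_const_bound[where B=1]) (use that in \<open>simp_all\<close>)
  have upper: "AE x in N. d x \<le> 1 + \<eta>"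
  proof -
    define A where "A = {x. 1 + \<eta> < d x}"
    have A [measurable]: "A \<in> sets borel"
      using d by (simp add: A_def)
    have "(\<integral>x. d x * indicator A x - (1 + \<eta>) * indicator A x \<partial>N) = measure N' A - (1 + \<eta>) * measure N A"
      using int_ind[OF A] set_int[OF A] ind[OF A] by (subst Bochner_Integration.integral_diff) auto
    also have "\<dots> \<le> 0"
      using close[OF A] by (simp add: abs_le_iff algebra_simps)
    finally have "(\<integral>x. d x * indicator A x - (1 + \<eta>) * indicator A x \<partial>N) \<le> 0" .
    moreover have "0 \<le> d x * indicator A x - (1 + \<eta>) * indicator A x" for x
      by (simp add: A_def indicator_def)
    moreover have i: "integrable N (\<lambda>x. d x * indicator A x - (1 + \<eta>) * indicator A x)"
      using int_ind[OF A] ind[OF A] by (intro Bochner_Integration.integrable_diff integrable_mult_right)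
    ultimately have "(\<integral>x. d x * indicator A x - (1 + \<eta>) * indicator A x \<partial>N) = 0"
      by (intro antisym integral_nonneg_AE) auto
    then have "AE x in N. d x * indicator A x - (1 + \<eta>) * indicator A x = 0"
      by (subst (asm) integral_nonneg_eq_0_iff_AE[OF i]) (auto simp: A_def indicator_def)
    then show ?thesis by eventually_elim (auto simp: A_def indicator_def split: if_splits)
  qed
  have lower: "AE x in N. 1 - \<eta> \<le> d x"
  proof -
    define A where "A = {x. d x < 1 - \<eta>}"
    have A [measurable]: "A \<in> sets borel"
      using d by (simp add: A_def)
    have "(\<integral>x. (1 - \<eta>) * indicator A x - d x * indicator A x \<partial>N) = (1 - \<eta>) * measure N A - measure N' A"
      using int_ind[OF A] set_int[OF A] ind[OF A] by (subst Bochner_Integration.integral_diff) auto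
    also have "\<dots> \<le> 0"
      using close[OF A] by (simp add: abs_le_iff algebra_simps)
    finally have "(\<integral>x. (1 - \<eta>) * indicator A x - d x * indicator A x \<partial>N) \<le> 0" .
    moreover have "0 \<le> (1 - \<eta>) * indicator A x - d x * indicator A x" for x
      by (simp add: A_def indicator_def)
    moreover have i: "integrable N (\<lambda>x. (1 - \<eta>) * indicator A x - d x * indicator A x)"
      using int_ind[OF A] ind[OF A] by (intro Bochner_Integration.integrable_diff integrable_mult_right)
    ultimately have "(\<integral>x. (1 - \<eta>) * indicator A x - d x * indicator A x \<partial>N) = 0"
      by (intro antisym integral_nonneg_AE) auto
    then have "AE x in N. (1 - \<eta>) * indicator A x - d x * indicator A x = 0"
      by (subst (asm) integral_nonneg_eq_0_iff_AE[OF i]) (auto simp: A_def indicator_def)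
    then show ?thesis by eventually_elim (auto simp: A_def indicator_def split: if_splits)
  qed
  \<comment> \<open>Truncation changes the derivative only on a null set and makes the bound hold
    everywhere, as \<open>perturbed_bandit\<close> demands.\<close>
  define f where "f x = max (1 - \<eta>) (min (1 + \<eta>) (d x))" for x
  show ?thesis
  proof
    show [measurable]: "f \<in> borel_measurable borel" using d by (simp add: f_def[abs_def])
    have "AE x in N. ennreal (d x) = ennreal (f x)"
      using upper lower by eventually_elim (simp add: f_def)
    then show "N' = density N f"
      unfolding dens by (intro density_cong) auto
    show "\<bar>f z - 1\<bar> \<le> \<eta>" for z using \<eta> by (auto simp: f_def)
  qed
qed

text \<open>Valid for every \<omega>, so recommendations lie in M everywhere and not just almost
  everywhere.\<close>

lemma hist_in_space: "hist pol n \<omega> t \<in> space (PiM {1..t} (\<lambda>_. borel))"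
proof (induction t)
  case (Suc t)
  then show ?case by (auto simp: space_PiM PiE_iff extensional_def Let_def)
qed (simp add: space_PiM)

lemma ip_in_unit:
  assumes "\<delta> \<in> simplexK K" and "\<And>i. i \<in> {1..K} \<Longrightarrow> \<tau> i \<in> {0..1}"
  shows "ip K \<tau> \<delta> \<in> {0..1}"
proof -
  have "0 \<le> ip K \<tau> \<delta>"
    unfolding ip_def using assms simplexK_bounds[OF assms(1)] by (intro sum_nonneg mult_nonneg_nonneg) auto
  moreover have "\<bar>ip K \<tau> \<delta>\<bar> \<le> 1"
    using assms by (intro abs_ip_le_one) auto
  ultimately show ?thesis by auto
qed

section \<open>The functional along the segment between the two distributions\<close>

locale mixture_functional =
  fixes T :: "(real \<Rightarrow> real) \<Rightarrow> real" and H1 H2 :: "real \<Rightarrow> real" and cm :: real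
  assumes cdf_J: "\<And>\<tau>. \<tau> \<in> {0..1} \<Longrightarrow> \<exists>N. real_distribution N \<and> Jmix H1 H2 \<tau> = cdf N"
    and cm: "0 < cm"
    and slope: "\<And>\<tau>1 \<tau>2. 0 \<le> \<tau>1 \<Longrightarrow> \<tau>1 \<le> \<tau>2 \<Longrightarrow> \<tau>2 \<le> 1 \<Longrightarrow>
      cm * (\<tau>2 - \<tau>1) \<le> T (Jmix H1 H2 \<tau>2) - T (Jmix H1 H2 \<tau>1)"
begin

abbreviation law :: "real \<Rightarrow> real measure" where
  "law \<tau> \<equiv> interval_measure (Jmix H1 H2 \<tau>)"

lemma law:
  assumes "\<tau> \<in> {0..1}"
  shows "real_distribution (law \<tau>)" "cdf (law \<tau>) = Jmix H1 H2 \<tau>"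
proof -
  obtain N where N: "real_distribution N" "Jmix H1 H2 \<tau> = cdf N" using cdf_J[OF assms] by blast
  interpret N: real_distribution N by fact
  show "real_distribution (law \<tau>)"
    unfolding N by (intro real_distribution_interval_measure N.cdf_nondecreasing N.cdf_is_right_cont
        N.cdf_lim_at_bot N.cdf_lim_at_top_prob)
  show "cdf (law \<tau>) = Jmix H1 H2 \<tau>"
    unfolding N by (intro cdf_interval_measure N.cdf_nondecreasing N.cdf_is_right_cont N.cdf_lim_at_bot)
qed

text \<open>With weights of at least 1/4 on both components, \<open>law \<tau>\<close> is at least a
  quarter of each, so the components differ by at most 4 times \<open>law \<tau>\<close> on every
  Borel set. This works even for mutually singular components.\<close>

lemma law_density:
  assumes \<tau>: "\<tau> \<in> {1/4..3/4}" and \<tau>': "\<tau>' \<in> {0..1}" and \<epsilon>: "\<bar>\<tau>' - \<tau>\<bar> \<le> \<epsilon>" "\<epsilon> \<le> 1 / 4"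
  obtains f :: "real \<Rightarrow> real" where "f \<in> borel_measurable borel" "law \<tau>' = density (law \<tau>) f"
    "\<And>z. \<bar>f z - 1\<bar> \<le> 4 * \<epsilon>"
proof (rule bounded_density_exists)
  have mix: "measure (law t) A = t * measure (law 1) A + (1 - t) * measure (law 0) A"
    if "t \<in> {0..1}" "A \<in> sets borel" for t A
  proof (rule measure_mixture)
    show "cdf (law t) x = t * cdf (law 1) x + (1 - t) * cdf (law 0) x" for x
      using that(1) by (simp add: law(2)) (simp add: Jmix_def)
  qed (use that in \<open>auto intro: law(1)\<close>)
  show "real_distribution (law \<tau>)" "real_distribution (law \<tau>')" using \<tau> \<tau>' by (auto intro: law)
  show "0 \<le> 4 * \<epsilon>" "4 * \<epsilon> \<le> 1" using \<epsilon> by auto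
  fix A :: "real set" assume A: "A \<in> sets borel"
  let ?a = "measure (law 1) A" and ?b = "measure (law 0) A"
  have "1 / 4 * ?a \<le> \<tau> * ?a" "1 / 4 * ?b \<le> (1 - \<tau>) * ?b" "0 \<le> \<tau> * ?a" "0 \<le> (1 - \<tau>) * ?b"
    using \<tau> mult_right_mono[OF _ measure_nonneg, of "1 / 4" \<tau> "law 1" A]
      mult_right_mono[OF _ measure_nonneg, of "1 / 4" "1 - \<tau>" "law 0" A] by auto
  moreover have "measure (law \<tau>) A = \<tau> * ?a + (1 - \<tau>) * ?b"
    using mix[of \<tau> A] \<tau> A by auto
  moreover have "0 \<le> ?a" "0 \<le> ?b" by auto
  ultimately have "\<bar>?a - ?b\<bar> \<le> 4 * measure (law \<tau>) A"
    by linarith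
  then have "\<bar>\<tau>' - \<tau>\<bar> * \<bar>?a - ?b\<bar> \<le> \<epsilon> * (4 * measure (law \<tau>) A)"
    using \<epsilon> by (intro mult_mono) auto
  moreover have "measure (law \<tau>') A - measure (law \<tau>) A = (\<tau>' - \<tau>) * (?a - ?b)"
    using mix[of \<tau> A] mix[of \<tau>' A] \<tau> \<tau>' A by (simp add: algebra_simps)
  ultimately show "\<bar>measure (law \<tau>') A - measure (law \<tau>) A\<bar> \<le> 4 * \<epsilon> * measure (law \<tau>) A"
    by (simp add: abs_mult)
qed (rule that; assumption)

lemma mix_Jmix:
  assumes "\<delta> \<in> simplexK K" and "\<And>i. i \<in> {1..K} \<Longrightarrow> F i = Jmix H1 H2 (\<tau> i)"
  shows "mix K \<delta> F = Jmix H1 H2 (ip K \<tau> \<delta>)"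
proof
  fix x
  have "mix K \<delta> F x = (\<Sum>i\<in>{1..K}. \<tau> i * \<delta> i * H1 x + (\<delta> i - \<tau> i * \<delta> i) * H2 x)"
    unfolding mix_def using assms(2) by (intro sum.cong) (auto simp: Jmix_def algebra_simps)
  also have "\<dots> = Jmix H1 H2 (ip K \<tau> \<delta>) x"
    using assms(1) by (simp add: sum.distrib sum_distrib_right[symmetric] sum_subtractf Jmix_def ip_def simplexK_def)
  finally show "mix K \<delta> F x = Jmix H1 H2 (ip K \<tau> \<delta>) x" .
qed

lemma T_mono:
  assumes "0 \<le> \<tau>1" "\<tau>1 \<le> \<tau>2" "\<tau>2 \<le> 1"
  shows "T (Jmix H1 H2 \<tau>1) \<le> T (Jmix H1 H2 \<tau>2)"
proof -
  have "0 \<le> cm * (\<tau>2 - \<tau>1)" using cm assms by simp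
  then show ?thesis using slope[OF assms] by linarith
qed

text \<open>The upper bound keeps the regret integrable and the worst case finite; in the third
  claim the slope of T turns a gap between weights into regret.\<close>

lemma best_minus_bounds:
  assumes M: "M \<subseteq> simplexK K" and \<delta>: "\<delta> \<in> M"
    and \<tau>: "\<And>i. i \<in> {1..K} \<Longrightarrow> \<tau> i \<in> {0..1}"
    and F: "\<And>i. i \<in> {1..K} \<Longrightarrow> F i = Jmix H1 H2 (\<tau> i)"
  shows "0 \<le> (SUP \<delta>\<in>M. T (mix K \<delta> F)) - T (mix K \<delta> F)"
    and "(SUP \<delta>\<in>M. T (mix K \<delta> F)) - T (mix K \<delta> F) \<le> T (Jmix H1 H2 1) - T (Jmix H1 H2 0)"
    and "\<And>\<gamma>. \<gamma> \<in> M \<Longrightarrow>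
      cm * (ip K \<tau> \<gamma> - ip K \<tau> \<delta>) \<le> (SUP \<delta>\<in>M. T (mix K \<delta> F)) - T (mix K \<delta> F)"
proof -
  have J: "T (mix K \<gamma> F) = T (Jmix H1 H2 (ip K \<tau> \<gamma>))" "ip K \<tau> \<gamma> \<in> {0..1}" if "\<gamma> \<in> M" for \<gamma>
    using that M mix_Jmix[OF _ F, of \<gamma> K] ip_in_unit[OF _ \<tau>, of \<gamma> K] by auto
  have range: "T (Jmix H1 H2 0) \<le> T (mix K \<gamma> F)" "T (mix K \<gamma> F) \<le> T (Jmix H1 H2 1)" if "\<gamma> \<in> M" for \<gamma>
    using J[OF that] by (auto intro: T_mono)
  then have bdd: "bdd_above ((\<lambda>\<delta>. T (mix K \<delta> F)) ` M)"
    by (intro bdd_aboveI2)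
  have le: "T (mix K \<gamma> F) \<le> (SUP \<delta>\<in>M. T (mix K \<delta> F))" if "\<gamma> \<in> M" for \<gamma>
    using that bdd by (rule cSUP_upper)
  show nonneg: "0 \<le> (SUP \<delta>\<in>M. T (mix K \<delta> F)) - T (mix K \<delta> F)"
    using le[OF \<delta>] by simp
  have "(SUP \<delta>\<in>M. T (mix K \<delta> F)) \<le> T (Jmix H1 H2 1)"
    using range \<delta> by (intro cSUP_least) auto
  then show "(SUP \<delta>\<in>M. T (mix K \<delta> F)) - T (mix K \<delta> F) \<le> T (Jmix H1 H2 1) - T (Jmix H1 H2 0)"
    using range[OF \<delta>] by linarith
  show "cm * (ip K \<tau> \<gamma> - ip K \<tau> \<delta>) \<le> (SUP \<delta>\<in>M. T (mix K \<delta> F)) - T (mix K \<delta> F)"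
    if \<gamma>: "\<gamma> \<in> M" for \<gamma>
  proof (cases "ip K \<tau> \<delta> \<le> ip K \<tau> \<gamma>")
    case True
    then show ?thesis
      using slope[of "ip K \<tau> \<delta>" "ip K \<tau> \<gamma>"] J[OF \<gamma>] J[OF \<delta>] le[OF \<gamma>] by auto
  next
    case False
    then have "cm * (ip K \<tau> \<gamma> - ip K \<tau> \<delta>) \<le> 0" using cm by (simp add: mult_le_0_iff)
    then show ?thesis using nonneg by linarith
  qed
qed

text \<open>Applied with A = S in the base instance and A = M - S in the alternative, g being the
  corresponding objective in \<open>kappa_obj\<close>.\<close>

lemma best_minus_ge:
  assumes M: "M \<subseteq> simplexK K" and A: "A \<subseteq> M" "\<delta> \<in> A"
    and \<tau>: "\<And>i. i \<in> {1..K} \<Longrightarrow> \<tau> i \<in> {0..1}"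
    and F: "\<And>i. i \<in> {1..K} \<Longrightarrow> F i = Jmix H1 H2 (\<tau> i)"
    and g: "\<And>\<gamma>. \<gamma> \<in> M \<Longrightarrow> ip K \<tau> \<gamma> = c + \<epsilon> * g \<gamma>" and \<epsilon>: "0 < \<epsilon>"
    and bdd: "bdd_above (g ` M)"
  shows "cm * \<epsilon> * ((SUP \<gamma>\<in>M. g \<gamma>) - (SUP \<gamma>\<in>A. g \<gamma>)) \<le> (SUP \<delta>\<in>M. T (mix K \<delta> F)) - T (mix K \<delta> F)"
    (is "_ \<le> ?R")
proof -
  have \<delta>: "\<delta> \<in> M" using A by auto
  have pos: "0 < cm * \<epsilon>" using cm \<epsilon> by simp
  have "g \<gamma> \<le> ?R / (cm * \<epsilon>) + g \<delta>" if "\<gamma> \<in> M" for \<gamma>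
  proof -
    have "cm * \<epsilon> * (g \<gamma> - g \<delta>) \<le> ?R"
      using best_minus_bounds(3)[where \<tau>=\<tau> and F=F, OF M \<delta> \<tau> F that] g[OF that] g[OF \<delta>] by (simp add: algebra_simps)
    then have "g \<gamma> - g \<delta> \<le> ?R / (cm * \<epsilon>)"
      using pos by (simp add: pos_le_divide_eq mult.commute)
    then show ?thesis by linarith
  qed
  then have "(SUP \<gamma>\<in>M. g \<gamma>) \<le> ?R / (cm * \<epsilon>) + g \<delta>"
    using \<delta> by (intro cSUP_least) auto
  moreover have "g \<delta> \<le> (SUP \<gamma>\<in>A. g \<gamma>)"
    using A bdd by (intro cSUP_upper bdd_above_mono[OF bdd]) auto
  ultimately have "(SUP \<gamma>\<in>M. g \<gamma>) - (SUP \<gamma>\<in>A. g \<gamma>) \<le> ?R / (cm * \<epsilon>)" by linarith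
  then show ?thesis using pos by (simp add: pos_le_divide_eq mult.commute)
qed

end

subsection \<open>Regret of a policy\<close>

locale bandit_problem = mixture_functional T H1 H2 cm + recommendation_set K M
  for T H1 H2 cm K M +
  fixes pol recf and PG :: "real measure" and n :: nat
  assumes policy: "is_policy K M pol recf"
    and PG: "prob_space PG" "sets PG = sets borel"
    and n: "K \<le> n"
begin

sublocale sampling_policy K n pol PG
  using policy n PG by (auto simp: sampling_policy_def is_policy_def)

lemma recf_measurable: "recf n \<in> (PiM {1..n} (\<lambda>_. borel) \<Otimes>\<^sub>M borel) \<rightarrow>\<^sub>M borel"
  using policy n by (auto simp: is_policy_def)

lemma recf_in: "recf n (hist pol n \<omega> n, g) \<in> M"
  using policy n hist_in_space[of pol n \<omega> n] by (auto simp: is_policy_def space_pair_measure)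

abbreviation recommended :: "(nat \<Rightarrow> (nat \<Rightarrow> real) \<times> real) \<Rightarrow> nat \<Rightarrow> real" where
  "recommended \<omega> \<equiv> recf n (hist pol n \<omega> n, snd (\<omega> (Suc n)))"

lemma bandit_law:
  assumes "\<And>i. \<tau> i \<in> {0..1}"
  shows "bandit K n pol PG (\<lambda>i. law (\<tau> i))"
  using law(1)[OF assms] sampling_policy_axioms
  by (simp add: bandit_def bandit_axioms_def real_distribution_def real_distribution_axioms_def)

lemma outcome_space_eq:
  assumes "\<And>i. \<tau> i \<in> {0..1}"
  shows "outcome_space K (\<lambda>i. Jmix H1 H2 (\<tau> i)) PG n = PiM {1..Suc n} (\<lambda>_. bandit.Q K PG (\<lambda>i. law (\<tau> i)))"
  by (simp add: outcome_space_def bandit.Q_def[OF bandit_law[OF assms]])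

text \<open>The upper bound is uniform in F, so the supremum in \<open>worst_regret\<close> is a
  genuine one.\<close>

lemma exp_regret_bounds:
  assumes F: "\<forall>i\<in>{1..K}. F i \<in> Jmix H1 H2 ` {0..1}"
  shows "0 \<le> exp_regret K M T F PG pol recf n"
    and "exp_regret K M T F PG pol recf n \<le> T (Jmix H1 H2 1) - T (Jmix H1 H2 0)"
proof -
  obtain \<tau> where \<tau>: "\<And>i. i \<in> {1..K} \<Longrightarrow> \<tau> i \<in> {0..1}" "\<And>i. i \<in> {1..K} \<Longrightarrow> F i = Jmix H1 H2 (\<tau> i)"
  proof -
    have "\<forall>i\<in>{1..K}. \<exists>t. t \<in> {0..1} \<and> F i = Jmix H1 H2 t" using F by blast
    from bchoice[OF this] show ?thesis using that by blast
  qed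
  note b = best_minus_bounds[where \<tau>=\<tau> and F=F, OF M(1) recf_in \<tau>]
  show "0 \<le> exp_regret K M T F PG pol recf n"
    unfolding exp_regret_def regret_def using b(1) by (intro integral_nonneg_AE) auto
  interpret PG: prob_space PG by (rule PG)
  have "prob_space (PiM {1..K} (\<lambda>i. interval_measure (F i)))"
    using \<tau> law(1) by (intro prob_space_PiM) (auto simp: real_distribution_def)
  then interpret Y: prob_space "PiM {1..K} (\<lambda>i. interval_measure (F i))" .
  interpret Q: pair_prob_space "PiM {1..K} (\<lambda>i. interval_measure (F i))" PG ..
  have "prob_space (outcome_space K F PG n)"
    unfolding outcome_space_def by (intro prob_space_PiM) unfold_locales
  then interpret P: prob_space "outcome_space K F PG n" .
  let ?R = "regret K M T F pol recf n"
  show "exp_regret K M T F PG pol recf n \<le> T (Jmix H1 H2 1) - T (Jmix H1 H2 0)"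
  proof (cases "integrable (outcome_space K F PG n) ?R")
    case True
    have "AE \<omega> in outcome_space K F PG n. ?R \<omega> \<le> T (Jmix H1 H2 1) - T (Jmix H1 H2 0)"
      using b(2) by (simp add: regret_def)
    with True show ?thesis
      unfolding exp_regret_def by (rule P.integral_le_const)
  next
    \<comment> \<open>A nonintegrable function has Bochner integral 0, which is also below the
      bound.\<close>
    case False
    then show ?thesis
      using T_mono[of 0 1] by (simp add: exp_regret_def not_integrable_integral_eq)
  qed
qed

text \<open>Markov's inequality: the regret is at least r when the recommendation falls in A, and
  nonnegative otherwise.\<close>

lemma exp_regret_ge_prob:
  assumes \<tau>: "\<And>i. \<tau> i \<in> {0..1}" and A: "A \<in> sets borel" 
    and r: "\<And>\<delta>. \<delta> \<in> M \<inter> A \<Longrightarrow>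
      r \<le> (SUP \<delta>\<in>M. T (mix K \<delta> (\<lambda>i. Jmix H1 H2 (\<tau> i)))) - T (mix K \<delta> (\<lambda>i. Jmix H1 H2 (\<tau> i)))"
  shows "r * (\<integral>\<omega>. indicator A (recommended \<omega>) \<partial>outcome_space K (\<lambda>i. Jmix H1 H2 (\<tau> i)) PG n)
    \<le> exp_regret K M T (\<lambda>i. Jmix H1 H2 (\<tau> i)) PG pol recf n"
proof -
  interpret B: bandit K n pol PG "\<lambda>i. law (\<tau> i)" by (rule bandit_law[OF \<tau>])
  let ?F = "\<lambda>i. Jmix H1 H2 (\<tau> i)"
  let ?R = "regret K M T ?F pol recf n"
  have rec [measurable]: "recommended \<in> B.P \<rightarrow>\<^sub>M borel"
    by (rule measurable_compose[OF B.measurable_observation recf_measurable])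
  note b = best_minus_bounds[where \<tau>=\<tau> and F="?F", OF M(1) recf_in \<tau> refl]
  \<comment> \<open>Along the segment T is monotone in the weight, which makes the regret
    measurable; clamping to [0,1] extends this monotonicity to the whole line.\<close>
  define U where "U x = T (Jmix H1 H2 (max 0 (min 1 x)))" for x
  have "mono U" by (auto simp: U_def mono_def intro!: T_mono)
  then have [measurable]: "U \<in> borel_measurable borel" by (rule borel_measurable_mono)
  have "continuous_on UNIV (ip K \<tau>)"
    unfolding ip_def[abs_def] by (intro continuous_intros)
  then have [measurable]: "ip K \<tau> \<in> borel_measurable borel"
    by (rule borel_measurable_continuous_onI)
  have "T (mix K (recommended \<omega>) ?F) = U (ip K \<tau> (recommended \<omega>))" for \<omega>
    using mix_Jmix[of "recommended \<omega>" K ?F \<tau>] ip_in_unit[of "recommended \<omega>" K \<tau>] recf_in[of \<omega>] M \<tau>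
    by (auto simp: U_def subset_iff)
  then have "?R = (\<lambda>\<omega>. (SUP \<delta>\<in>M. T (mix K \<delta> ?F)) - U (ip K \<tau> (recommended \<omega>)))"
    by (simp add: regret_def fun_eq_iff)
  then have mR: "?R \<in> borel_measurable B.P" by simp
  have intR: "integrable B.P ?R"
  proof (rule B.rounds.P.integrable_const_bound[OF AE_I2 mR])
    show "norm (?R \<omega>) \<le> T (Jmix H1 H2 1) - T (Jmix H1 H2 0)" for \<omega>
      using b(1,2)[of \<omega> "snd (\<omega> (Suc n))"] by (simp add: regret_def)
  qed
  have mI: "(\<lambda>\<omega>. indicator A (recommended \<omega>) :: real) \<in> borel_measurable B.P"
    using A by measurable
  have intI: "integrable B.P (\<lambda>\<omega>. indicator A (recommended \<omega>) :: real)"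
    by (rule B.rounds.P.integrable_const_bound[where B=1, OF AE_I2 mI]) (simp add: indicator_def)
  have "(\<integral>\<omega>. r * indicator A (recommended \<omega>) \<partial>B.P) \<le> (\<integral>\<omega>. ?R \<omega> \<partial>B.P)"
  proof (rule integral_mono[OF _ intR])
    show "r * indicator A (recommended \<omega>) \<le> ?R \<omega>" for \<omega>
      using r[of "recommended \<omega>"] recf_in[of \<omega>] b(1)[of \<omega> "snd (\<omega> (Suc n))"]
      by (simp add: regret_def indicator_def)
  qed (use intI in simp)
  then show ?thesis
    by (simp add: exp_regret_def outcome_space_eq[OF \<tau>])
qed

abbreviation worst_regret :: real where
  "worst_regret \<equiv>
     (SUP F\<in>{F. \<forall>i\<in>{1..K}. F i \<in> Jmix H1 H2 ` {0..1}}. exp_regret K M T F PG pol recf n)"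

lemma exp_regret_le_worst:
  assumes "\<forall>i\<in>{1..K}. F i \<in> Jmix H1 H2 ` {0..1}"
  shows "exp_regret K M T F PG pol recf n \<le> worst_regret"
  using assms exp_regret_bounds(2) by (intro cSUP_upper bdd_aboveI2) auto

lemma worst_regret_nonneg: "0 \<le> worst_regret"
proof -
  have F: "\<forall>i\<in>{1..K}. (\<lambda>_. Jmix H1 H2 0) i \<in> Jmix H1 H2 ` {0..1}" by auto
  show ?thesis
    using exp_regret_bounds(1)[OF F] exp_regret_le_worst[OF F] by linarith
qed

text \<open>The base instance moves the mixture weight of arm \<open>i\<close> to \<open>1/2 + \<epsilon> v i\<close>. The alternative moves
  the weight of one rarely pulled arm by a further \<open>\<epsilon> w i\<close>, too little to be detected, although
  it turns the set of bad recommendations from \<open>S\<close> into its complement.\<close>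

lemma worst_regret_ge_kappa_obj:
  assumes S: "S \<in> sets borel" "S \<noteq> {}" "S \<subset> M"
    and vw: "\<forall>i\<in>{1..K}. \<bar>v i\<bar> \<le> 1 \<and> \<bar>w i\<bar> \<le> 1"
  shows "cm / 128 * kappa_obj K M S v w * sqrt (real K / real n) \<le> worst_regret"
proof (cases "kappa_obj K M S v w \<le> 0")
  case True
  then have "cm / 128 * kappa_obj K M S v w * sqrt (real K / real n) \<le> 0"
    using cm by (intro mult_nonpos_nonneg mult_nonneg_nonpos) auto
  then show ?thesis using worst_regret_nonneg by linarith
next
  case False
  define \<kappa> where "\<kappa> = kappa_obj K M S v w"
  have \<kappa>: "0 < \<kappa>" using False by (simp add: \<kappa>_def)
  \<comment> \<open>The factor 1/8 keeps the base weights within 1/8 of 1/2 and makes the budget 2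
    (4 \<epsilon>)^2 n / K equal to 1/2.\<close>
  define \<epsilon> where "\<epsilon> = sqrt (real K / real n) / 8"
  have \<epsilon>: "0 < \<epsilon>" "\<epsilon> \<le> 1 / 8" and \<epsilon>_sq: "\<epsilon>\<^sup>2 = real K / real n / 64"
    using K n by (auto simp: \<epsilon>_def power_divide)
  \<comment> \<open>The value 1/2 outside {1..K} makes \<open>law (\<tau> i)\<close> a probability
    measure for every index, as \<open>bandit\<close> requires.\<close>
  define \<tau> where "\<tau> i = (if i \<in> {1..K} then 1 / 2 + \<epsilon> * v i else 1 / 2)" for i
  have \<epsilon>_mult: "\<bar>\<epsilon> * x\<bar> \<le> \<epsilon>" if "\<bar>x\<bar> \<le> 1" for x
    using that \<epsilon> by (simp add: abs_mult mult_left_le)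
  have \<tau>_mid: "\<tau> i \<in> {3/8..5/8}" for i
  proof (cases "i \<in> {1..K}")
    case True
    then have "\<bar>\<epsilon> * v i\<bar> \<le> \<epsilon>" using \<epsilon>_mult vw by blast
    moreover have "\<tau> i = 1 / 2 + \<epsilon> * v i" using True by (simp add: \<tau>_def)
    ultimately show ?thesis using \<epsilon> unfolding atLeastAtMost_iff by linarith
  qed (auto simp: \<tau>_def)
  have \<tau>: "\<tau> i \<in> {0..1}" for i
    using \<tau>_mid[of i] by simp
  interpret base: bandit K n pol PG "\<lambda>i. law (\<tau> i)" by (rule bandit_law[OF \<tau>])
  \<comment> \<open>This arm depends on the policy and, through the base instance, on v; S and w
    were fixed earlier and have to serve whichever arm it is.\<close>
  obtain i where i: "i \<in> {1..K}"
    and rare: "(\<Sum>s\<in>{1..n}. \<integral>\<omega>. (if arm s \<omega> = i then 1 else 0) \<partial>base.P) \<le> real n / real K"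
    using base.ex_rarely_pulled_arm K by auto
  define \<tau>' where "\<tau>' = \<tau>(i := \<tau> i + \<epsilon> * w i)"
  have shift: "\<bar>\<epsilon> * w i\<bar> \<le> \<epsilon>" using \<epsilon>_mult vw i by auto
  have \<tau>': "\<tau>' j \<in> {0..1}" for j
  proof (cases "j = i")
    case True
    then have "\<tau>' j = \<tau> i + \<epsilon> * w i" by (simp add: \<tau>'_def)
    then show ?thesis
      using \<tau>_mid[of i] shift \<epsilon> unfolding atLeastAtMost_iff by linarith
  next
    case False
    then show ?thesis using \<tau>[of j] by (simp add: \<tau>'_def)
  qed
  have "\<tau> i \<in> {1/4..3/4}" "\<bar>\<tau>' i - \<tau> i\<bar> \<le> \<epsilon>" "\<epsilon> \<le> 1 / 4"
    using \<tau>_mid[of i] shift \<epsilon> by (auto simp: \<tau>'_def)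
  then obtain f where f: "f \<in> borel_measurable borel" "law (\<tau>' i) = density (law (\<tau> i)) f"
    "\<And>z. \<bar>f z - 1\<bar> \<le> 4 * \<epsilon>"
    using law_density[of "\<tau> i" "\<tau>' i" \<epsilon>] \<tau>'[of i] by metis
  interpret alt: bandit K n pol PG "\<lambda>i. law (\<tau>' i)" by (rule bandit_law[OF \<tau>'])
  interpret perturbed_bandit K n pol PG "\<lambda>i. law (\<tau> i)" "\<lambda>i. law (\<tau>' i)" i f "4 * \<epsilon>"
    using i f \<epsilon> by unfold_locales (auto simp: \<tau>'_def)
  have ip_\<tau>: "ip K \<tau> \<delta> = 1 / 2 + \<epsilon> * ip K v \<delta>" if "\<delta> \<in> M" for \<delta>
  proof -
    have "ip K \<tau> \<delta> = (\<Sum>j\<in>{1..K}. 1 / 2 * \<delta> j + \<epsilon> * (v j * \<delta> j))"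
      unfolding ip_def by (intro sum.cong) (auto simp: \<tau>_def algebra_simps)
    also have "\<dots> = 1 / 2 * (\<Sum>j\<in>{1..K}. \<delta> j) + \<epsilon> * ip K v \<delta>"
      by (simp only: sum.distrib sum_distrib_left ip_def)
    finally show ?thesis using that M by (auto simp: simplexK_def)
  qed
  have ip_\<tau>': "ip K \<tau>' \<delta> = 1 / 2 + \<epsilon> * (ip K v \<delta> + w i * \<delta> i)" if "\<delta> \<in> M" for \<delta>
  proof -
    have "ip K \<tau>' \<delta> = (\<Sum>j\<in>{1..K}. \<tau> j * \<delta> j + (if j = i then \<epsilon> * w i * \<delta> i else 0))"
      unfolding ip_def by (intro sum.cong) (auto simp: \<tau>'_def algebra_simps)
    also have "\<dots> = ip K \<tau> \<delta> + \<epsilon> * w i * \<delta> i"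
      using i by (simp add: sum.distrib ip_def)
    finally show ?thesis using ip_\<tau>[OF that] by (simp add: algebra_simps)
  qed
  have bdd: "bdd_above ((\<lambda>\<delta>. ip K v \<delta>) ` M)" "bdd_above ((\<lambda>\<delta>. ip K v \<delta> + w i * \<delta> i) ` M)"
    using vw i by (auto intro!: bdd_above_ip bdd_above_perturbed_ip)
  have gap: "\<kappa> \<le> (SUP \<delta>\<in>M. ip K v \<delta>) - (SUP \<delta>\<in>S. ip K v \<delta>)"
    "\<kappa> \<le> (SUP \<delta>\<in>M. ip K v \<delta> + w i * \<delta> i) - (SUP \<delta>\<in>M - S. ip K v \<delta> + w i * \<delta> i)"
    using i by (auto simp: \<kappa>_def kappa_obj_def min_le_iff_disj intro!: min.coboundedI2 Min_le)
  let ?r = "cm * \<epsilon> * \<kappa>"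
  let ?F = "\<lambda>i. Jmix H1 H2 (\<tau> i)" and ?F' = "\<lambda>i. Jmix H1 H2 (\<tau>' i)"
  have scale: "?r \<le> cm * \<epsilon> * x" if "\<kappa> \<le> x" for x
    using that cm \<epsilon> by (intro mult_left_mono) auto
  have "?r \<le> (SUP \<delta>\<in>M. T (mix K \<delta> ?F)) - T (mix K \<delta> ?F)" if "\<delta> \<in> M \<inter> S" for \<delta>
    using that S \<tau> by (intro order.trans[OF scale[OF gap(1)] best_minus_ge[OF M(1) _ _ _ _ ip_\<tau> \<epsilon>(1) bdd(1)]]) auto
  then have "?r * (\<integral>\<omega>. indicator S (recommended \<omega>) \<partial>base.P) \<le> exp_regret K M T ?F PG pol recf n"
    using exp_regret_ge_prob[OF \<tau> S(1)] by (simp add: outcome_space_eq[OF \<tau>])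
  moreover have "?r \<le> (SUP \<delta>\<in>M. T (mix K \<delta> ?F')) - T (mix K \<delta> ?F')" if "\<delta> \<in> M \<inter> - S" for \<delta>
    using that S \<tau>' by (intro order.trans[OF scale[OF gap(2)] best_minus_ge[OF M(1) _ _ _ _ ip_\<tau>' \<epsilon>(1) bdd(2)]]) auto
  then have "?r * (\<integral>\<omega>. indicator (- S) (recommended \<omega>) \<partial>alt.P) \<le> exp_regret K M T ?F' PG pol recf n"
    using exp_regret_ge_prob[OF \<tau>', of "- S"] S(1) by (simp add: outcome_space_eq[OF \<tau>'])
  moreover have "(1 / 8 :: real) \<le> (\<integral>\<omega>. indicator S (recommended \<omega>) \<partial>base.P) + (\<integral>\<omega>. indicator (- S) (recommended \<omega>) \<partial>alt.P)"
  proof -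
    define A where "A = recf n -` S \<inter> space (PiM {1..n} (\<lambda>_. borel) \<Otimes>\<^sub>M borel)"
    have A: "A \<in> sets (PiM {1..n} (\<lambda>_. borel) \<Otimes>\<^sub>M borel)"
      unfolding A_def using recf_measurable S(1) by (rule measurable_sets)
    have "2 * (4 * \<epsilon>)\<^sup>2 * (\<Sum>s\<in>{1..n}. \<integral>\<omega>. pulled s \<omega> \<partial>base.P) \<le> 2 * (4 * \<epsilon>)\<^sup>2 * (real n / real K)"
      using rare by (intro mult_left_mono) (auto simp: pulled_def)
    also have "\<dots> \<le> 1" using K n by (simp add: power_mult_distrib \<epsilon>_sq)
    finally have "(1 / 8 :: real) \<le> (\<integral>\<omega>. indicator A (observation \<omega>) \<partial>base.P)
               + (\<integral>\<omega>. 1 - indicator A (observation \<omega>) \<partial>alt.P)"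
      by (rule two_point_bound[OF A])
    moreover have "observation \<omega> \<in> space (PiM {1..n} (\<lambda>_. borel) \<Otimes>\<^sub>M borel)" for \<omega>
      using hist_in_space[of pol n \<omega> n] by (simp add: space_pair_measure)
    then have "indicator A (observation \<omega>) = (indicator S (recommended \<omega>) :: real)"
      "1 - indicator A (observation \<omega>) = (indicator (- S) (recommended \<omega>) :: real)" for \<omega>
      by (auto simp: A_def indicator_def)
    ultimately show ?thesis by simp
  qed
  then have "?r * (1 / 8) \<le> ?r * ((\<integral>\<omega>. indicator S (recommended \<omega>) \<partial>base.P) + (\<integral>\<omega>. indicator (- S) (recommended \<omega>) \<partial>alt.P))"
    using cm \<epsilon> \<kappa> by (intro mult_left_mono) auto
  moreover have "exp_regret K M T ?F PG pol recf n \<le> worst_regret" "exp_regret K M T ?F' PG pol recf n \<le> worst_regret"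
    using \<tau> \<tau>' by (auto intro!: exp_regret_le_worst)
  ultimately have "?r * (1 / 8) \<le> 2 * worst_regret"
    unfolding distrib_left by linarith
  then show ?thesis by (simp add: \<kappa>_def[symmetric] \<epsilon>_def mult_ac)
qed

text \<open>No maximiser of \<open>kappa\<close> is at hand, so the bound for each S, v, w is
  divided by the positive factor s before passing to the supremum.\<close>

lemma worst_regret_ge_kappa: "cm / 128 * kappa K M * sqrt (real K / real n) \<le> worst_regret"
proof -
  define s where "s = cm / 128 * sqrt (real K / real n)"
  have s: "0 < s" using cm K n by (simp add: s_def)
  obtain x y where xy: "x \<in> M" "y \<in> M" "x \<noteq> y" using two_elements by blast
  have "kappa K M \<le> worst_regret / s"
    unfolding kappa_def
  proof (rule cSUP_least)
    have "({x}, \<lambda>_. 0, \<lambda>_. 0) \<in> {(S, v, w). S \<in> sets borel \<and> S \<noteq> {} \<and> S \<subset> M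
        \<and> (\<forall>i\<in>{1..K}. \<bar>v i :: real\<bar> \<le> 1 \<and> \<bar>w i :: real\<bar> \<le> 1)}"
      using xy by auto
    then show "{(S, v, w). S \<in> sets borel \<and> S \<noteq> {} \<and> S \<subset> M
        \<and> (\<forall>i\<in>{1..K}. \<bar>v i :: real\<bar> \<le> 1 \<and> \<bar>w i :: real\<bar> \<le> 1)} \<noteq> {}" by (metis empty_iff)
  next
    fix p :: "(nat \<Rightarrow> real) set \<times> (nat \<Rightarrow> real) \<times> (nat \<Rightarrow> real)"
    assume p: "p \<in> {(S, v, w). S \<in> sets borel \<and> S \<noteq> {} \<and> S \<subset> M
        \<and> (\<forall>i\<in>{1..K}. \<bar>v i\<bar> \<le> 1 \<and> \<bar>w i\<bar> \<le> 1)}"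
    obtain S v w where "p = (S, v, w)" by (cases p)
    with p worst_regret_ge_kappa_obj[of S v w] s
    show "kappa_obj K M (fst p) (fst (snd p)) (snd (snd p)) \<le> worst_regret / s"
      by (simp add: pos_le_divide_eq s_def mult_ac)
  qed
  then show ?thesis using s by (simp add: pos_le_divide_eq s_def mult_ac)
qed

end

theorem theorem3p2:
  fixes a b C cm :: real and D :: "(real \<Rightarrow> real) set" and T :: "(real \<Rightarrow> real) \<Rightarrow> real"
    and H1 H2 :: "real \<Rightarrow> real"
  assumes "a < b"
    and "D \<subseteq> Dcdf a b" and "D \<noteq> {}" and "convex_fset D"
    and "C > 0" and "\<forall>F\<in>D. \<forall>G\<in>Dcdf a b. \<bar>T F - T G\<bar> \<le> C * supdist F G"
    and "H1 \<in> D" and "H2 \<in> D" and "\<forall>\<tau>\<in>{0..1}. Jmix H1 H2 \<tau> \<in> D"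
    and "cm > 0"
    and "\<forall>\<tau>1 \<tau>2. 0 \<le> \<tau>1 \<and> \<tau>1 \<le> \<tau>2 \<and> \<tau>2 \<le> 1 \<longrightarrow>
           T (Jmix H1 H2 \<tau>2) - T (Jmix H1 H2 \<tau>1) \<ge> cm * (\<tau>2 - \<tau>1)"
  shows "(\<exists>c>0. \<forall>K M pol recf PG n.
            2 \<le> K \<and> M \<subseteq> simplexK K \<and> closed M \<and> (\<exists>x\<in>M. \<exists>y\<in>M. x \<noteq> y)
            \<and> is_policy K M pol recf \<and> prob_space PG \<and> sets PG = sets borel \<and> K \<le> n \<longrightarrow>
            (SUP F\<in>{F. \<forall>i\<in>{1..K}. F i \<in> Jmix H1 H2 ` {0..1}}. exp_regret K M T F PG pol recf n)
              \<ge> c * kappa K M * sqrt (real K / real n))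
       \<and> (\<forall>K M. 2 \<le> K \<and> M \<subseteq> simplexK K \<and> closed M \<and> (\<exists>x\<in>M. \<exists>y\<in>M. x \<noteq> y) \<longrightarrow>
            kappa K M \<ge> 1 / 272 * (SUP \<delta>\<in>M. sqnorm K \<delta>)
                          * (Min ((\<lambda>j. (SUP \<delta>\<in>M. \<delta> j) - (INF \<delta>\<in>M. \<delta> j)) ` {1..K})) ^ 3
          \<and> kappa K M \<ge> (max (Min ((\<lambda>j. SUP \<delta>\<in>M. \<delta> j) ` {1..K}) - 1 / 2) 0) ^ 2)"
proof (intro conjI exI[where x="cm / 128"] allI impI)
  show "0 < cm / 128" using assms by simp
  have J: "\<exists>N. real_distribution N \<and> Jmix H1 H2 \<tau> = cdf N" if "\<tau> \<in> {0..1}" for \<tau>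
    using assms(2,9) that unfolding Dcdf_def by blast
  have functional: "mixture_functional T H1 H2 cm"
    using assms(10,11) J by unfold_locales auto
  show "cm / 128 * kappa K M * sqrt (real K / real n)
      \<le> (SUP F\<in>{F. \<forall>i\<in>{1..K}. F i \<in> Jmix H1 H2 ` {0..1}}. exp_regret K M T F PG pol recf n)"
    if "2 \<le> K \<and> M \<subseteq> simplexK K \<and> closed M \<and> (\<exists>x\<in>M. \<exists>y\<in>M. x \<noteq> y)
      \<and> is_policy K M pol recf \<and> prob_space PG \<and> sets PG = sets borel \<and> K \<le> n" for K M pol recf PG n
  proof -
    interpret bandit_problem T H1 H2 cm K M pol recf PG n
      using that functional
      by (simp add: bandit_problem_def recommendation_set_def bandit_problem_axioms_def)
    show ?thesis by (rule worst_regret_ge_kappa)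
  qed
  fix K M assume "2 \<le> K \<and> M \<subseteq> simplexK K \<and> closed M \<and> (\<exists>x\<in>M. \<exists>y\<in>M. x \<noteq> y)"
  then interpret recommendation_set K M
    by (simp add: recommendation_set_def)
  show "kappa K M \<ge> 1 / 272 * (SUP \<delta>\<in>M. sqnorm K \<delta>)
          * (Min ((\<lambda>j. (SUP \<delta>\<in>M. \<delta> j) - (INF \<delta>\<in>M. \<delta> j)) ` {1..K})) ^ 3"
    by (rule kappa_ge_sqnorm)
  show "kappa K M \<ge> (max (Min ((\<lambda>j. SUP \<delta>\<in>M. \<delta> j) ` {1..K}) - 1 / 2) 0) ^ 2"
    by (rule kappa_ge_coordinate_max)
qed

end
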